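(* Let $m\ge 5$ be an integer and let $G$ be a connected simple graph with exactly $m$ edges such that $G$ is isomorphic to neither $P_{m+1}$ nor $A_{m+1}$. Then $$\rho(G)\le \rho(B_{m+1})<\rho(A_{m+1})<\rho(P_{m+1}),$$ with equality in the first inequality if and only if $G\cong B_{m+1}$.
   Context: All graphs are finite and simple. For a connected graph $G$, the distance matrix is $D(G)=(d_G(u,v))_{u,v\in V(G)}$, where $d_G(u,v)$ is the length of a shortest path between $u$ and $v$; the distance spectral radius $\rho(G)$ is the largest eigenvalue of the real symmetric matrix $D(G)$. $P_n$ is the path on $n$ vertices. For $n\ge 4$, $A_n$ is the tree on $n$ vertices obtained from a path $v_1v_2\cdots v_{n-1}$ by adding a new vertex $v_n$ and the edge $v_nv_2$. For $n\ge 6$, $B_n$ is the tree on $n$ vertices obtained from a path $v_1v_2\cdots v_{n-1}$ by adding a new vertex $v_n$ and the edge $v_nv_3$. *)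

theory Defs
  imports
    "Graph_Theory.Graph_Theory"
    "Jordan_Normal_Form.Spectral_Radius"
    "HOL-Library.Countable_Set"
begin

text \<open>
  A finite simple graph is a \<^locale>\<open>pair_graph\<close>: a finite loop-free digraph whose arc relation is
  symmetric. Each undirected edge thus appears as two opposite arcs, so edges are counted
  as unordered pairs.
\<close>

definition edges :: "'a pair_pre_digraph \<Rightarrow> 'a set set" where
  "edges G = (\<lambda>(u, v). {u, v}) ` parcs G"

abbreviation graph_iso :: "'a pair_pre_digraph \<Rightarrow> 'b pair_pre_digraph \<Rightarrow> bool"
    (infix \<open>\<cong>\<^sub>g\<close> 50) where
  "G \<cong>\<^sub>g H \<equiv> digraph_iso (with_proj G) (with_proj H)"

definition graph_dist :: "'a pair_pre_digraph \<Rightarrow> 'a \<Rightarrow> 'a \<Rightarrow> nat" where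
  "graph_dist G u v = (LEAST k. \<exists>p. pre_digraph.apath (with_proj G) u p v \<and> length p = k)"

text \<open>
  Matrices are indexed by \<open>{..<n}\<close>, so the finite vertex set is enumerated by
  \<^const>\<open>from_nat_into\<close>. A different enumeration gives a permutation-similar matrix, hence the
  same eigenvalues.
\<close>

definition distance_matrix :: "'a pair_pre_digraph \<Rightarrow> real mat" where
  "distance_matrix G =
     mat (card (pverts G)) (card (pverts G))
       (\<lambda>(i, j). real (graph_dist G (from_nat_into (pverts G) i) (from_nat_into (pverts G) j)))"

text \<open>
  The library's \<open>spectral_radius\<close> is for complex matrices and takes moduli; here the largest
  (real) eigenvalue is meant.
\<close>

definition distance_spectral_radius :: "'a pair_pre_digraph \<Rightarrow> real" (\<open>\<rho>\<close>) where
  "\<rho> G = Max (spectrum (distance_matrix G))"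

definition path_graph :: "nat \<Rightarrow> nat pair_pre_digraph" where
  "path_graph n =
     \<lparr> pverts = {1..n},
       parcs = {(i, j). i \<in> {1..n} \<and> j \<in> {1..n} \<and> (j = i + 1 \<or> i = j + 1)} \<rparr>"

definition add_pendant :: "'a pair_pre_digraph \<Rightarrow> 'a \<Rightarrow> 'a \<Rightarrow> 'a pair_pre_digraph" where
  "add_pendant G w u =
     \<lparr> pverts = insert w (pverts G), parcs = parcs G \<union> {(w, u), (u, w)} \<rparr>"

text \<open>\<open>A_graph n\<close> and \<open>B_graph n\<close> have \<open>n\<close> vertices and are meant for \<open>n \<ge> 4\<close> and
  \<open>n \<ge> 6\<close>, respectively.\<close>

definition A_graph :: "nat \<Rightarrow> nat pair_pre_digraph" where
  "A_graph n = add_pendant (path_graph (n - 1)) n 2"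

definition B_graph :: "nat \<Rightarrow> nat pair_pre_digraph" where
  "B_graph n = add_pendant (path_graph (n - 1)) n 3"

end

theory Submission
  imports Defs "HOL-Analysis.Function_Topology"
begin

text \<open>
  For a connected graph, the distance spectral radius is the maximum of the quadratic form
  of the distance matrix on unit vectors. It is attained at a nonnegative eigenvector, which is
  positive as soon as there are two vertices. Hence if a change of the graph
  increases the form at the Perron vector of the old graph, it increases the radius.

  The change used throughout is to take a vertex \<open>u\<close> of a tree, with neighbours \<open>i \<noteq> j\<close>, and to
  reattach the branch hanging at \<open>j\<close> to \<open>i\<close> instead of \<open>u\<close>. Only the distances between this branch
  and the rest change: by \<open>-1\<close> to the branch at \<open>i\<close>, and by \<open>+1\<close> to everything else. So the form
  changes by \<open>2 w\<^sub>j (S - w\<^sub>j - 2 w\<^sub>i)\<close>, where \<open>w\<close> denotes the Perron weight of a branch and \<open>S\<close> the total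
  weight (\<open>move_tree\<close>). If a third branch at \<open>u\<close> weighs at least \<open>w\<^sub>i\<close>, this is positive. Therefore,
  at a vertex of degree at least three, any two branches other than a heaviest one may be moved
  onto each other, in either order (\<open>move_increases_radius\<close>).

  On a given finite vertex set there are finitely many trees, so it suffices to improve every tree
  that is not of the desired shape, within the class considered (\<open>maximal_tree\<close>). A tree with a
  vertex of degree three can be improved, so the best tree is the path. A tree with such a vertex
  which is not \<open>A\<close> can be improved to another one with such a vertex, so \<open>A\<close> comes second. For the
  third place, a tree which is neither a path nor \<open>A\<close> nor \<open>B\<close> has to be improved to one which is
  neither a path nor \<open>A\<close>. A single move does this, except when every vertex of degree at least
  three has degree exactly three and carries two leaves; then there are two such forks, with leaf
  weights \<open>\<alpha>\<close> at \<open>u\<close> and \<open>\<gamma>\<close> at \<open>v\<close>. Four moves straighten the fork at \<open>u\<close> outwards and shift a leaf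
  at \<open>v\<close> to the end; the form changes by twice \<open>(\<gamma> - \<alpha>) S + 4 \<alpha> x\<^sub>u + \<alpha>\<^sup>2 - 3 \<gamma>\<^sup>2\<close>. The same with the
  roles of \<open>u\<close> and \<open>v\<close> exchanged gives a second tree, and the two changes add up to
  a positive multiple of \<open>\<alpha> (2 x\<^sub>u - \<alpha>) + \<gamma> (2 x\<^sub>v - \<gamma>)\<close>, which is positive since a leaf of a fork weighs less
  than twice its centre (\<open>fork_weights\<close>, \<open>better_tree_two_forks\<close>).

  Finally, a connected graph with \<open>m\<close> edges has at most \<open>m + 1\<close> vertices. With \<open>m + 1\<close> vertices it is
  a tree. With fewer, a spanning tree has at least its radius, a path at least that of the
  spanning tree, and the path on \<open>m\<close> vertices is an isometric proper subgraph of \<open>B\<close>, whose radius is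
  therefore strictly larger.
\<close>

section \<open>The largest eigenvalue of a symmetric nonnegative matrix\<close>

definition quad :: "'a set \<Rightarrow> ('a \<Rightarrow> 'a \<Rightarrow> real) \<Rightarrow> ('a \<Rightarrow> real) \<Rightarrow> real" where
  "quad V d x = (\<Sum>u\<in>V. \<Sum>v\<in>V. d u v * x u * x v)"

text \<open>
  A bound for the form together with a nonnegative eigenvector that attains it determines \<open>\<mu>\<close>. This
  form of the largest eigenvalue needs no enumeration of \<open>V\<close> and transports along bijections.
\<close>

definition top_eigenvalue :: "'a set \<Rightarrow> ('a \<Rightarrow> 'a \<Rightarrow> real) \<Rightarrow> real \<Rightarrow> bool" where
  "top_eigenvalue V d \<mu> \<longleftrightarrow>
     (\<forall>x. quad V d x \<le> \<mu> * (\<Sum>v\<in>V. (x v)\<^sup>2)) \<and>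
     (\<exists>x. (\<forall>v\<in>V. 0 \<le> x v) \<and> (\<exists>v\<in>V. x v \<noteq> 0) \<and> (\<forall>u\<in>V. (\<Sum>v\<in>V. d u v * x v) = \<mu> * x u))"

lemma quad_eigenvector:
  assumes "\<forall>u\<in>V. (\<Sum>v\<in>V. d u v * x v) = \<mu> * x u"
  shows "quad V d x = \<mu> * (\<Sum>v\<in>V. (x v)\<^sup>2)"
proof -
  have "quad V d x = (\<Sum>u\<in>V. x u * (\<Sum>v\<in>V. d u v * x v))"
    unfolding quad_def sum_distrib_left by (simp add: algebra_simps)
  also have "\<dots> = (\<Sum>u\<in>V. \<mu> * (x u)\<^sup>2)"
    using assms by (intro sum.cong) (auto simp: power2_eq_square)
  finally show ?thesis by (simp add: sum_distrib_left)
qed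

lemma sum_squares_pos:
  fixes x :: "'a \<Rightarrow> real"
  assumes "finite V" "v \<in> V" "x v \<noteq> 0"
  shows "0 < (\<Sum>v\<in>V. (x v)\<^sup>2)"
  using assms by (intro sum_pos2[of V v]) auto

lemma top_eigenvalue_unique:
  assumes "finite V" "top_eigenvalue V d \<mu>" "top_eigenvalue V d \<nu>"
  shows "\<mu> = \<nu>"
proof -
  have *: "\<mu> \<le> \<nu>" if \<mu>: "top_eigenvalue V d \<mu>" and \<nu>: "top_eigenvalue V d \<nu>" for \<mu> \<nu>
  proof -
    obtain x v where x: "v \<in> V" "x v \<noteq> 0" "\<forall>u\<in>V. (\<Sum>v\<in>V. d u v * x v) = \<mu> * x u"
      using \<mu> unfolding top_eigenvalue_def by blast
    have "\<mu> * (\<Sum>v\<in>V. (x v)\<^sup>2) \<le> \<nu> * (\<Sum>v\<in>V. (x v)\<^sup>2)"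
      using \<nu> quad_eigenvector[OF x(3)] unfolding top_eigenvalue_def by metis
    with sum_squares_pos[OF assms(1) x(1), of x] x(2) show ?thesis by simp
  qed
  show ?thesis using *[OF assms(2,3)] *[OF assms(3,2)] by simp
qed

text \<open>
  At a maximiser \<open>x\<close> of the Rayleigh quotient the first variation vanishes. If it did not, moving
  along the residual \<open>r = d x - \<mu> x\<close> would push the form above the bound.
\<close>

lemma maximiser_is_eigenvector:
  assumes fin: "finite V" and sym: "\<And>u v. d u v = d v u"
    and bound: "\<And>y. quad V d y \<le> \<mu> * (\<Sum>v\<in>V. (y v)\<^sup>2)"
    and max: "quad V d x = \<mu> * (\<Sum>v\<in>V. (x v)\<^sup>2)"
    and u: "u \<in> V"
  shows "(\<Sum>v\<in>V. d u v * x v) = \<mu> * x u"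
proof (rule ccontr)
  assume neq: "\<not> ?thesis"
  define r where "r u = (\<Sum>v\<in>V. d u v * x v) - \<mu> * x u" for u
  define c where "c = (\<Sum>u\<in>V. (r u)\<^sup>2)"
  define K where "K = quad V d r - \<mu> * (\<Sum>v\<in>V. (r v)\<^sup>2)"
  have "r u \<noteq> 0" using neq by (simp add: r_def)
  then have c: "c > 0" unfolding c_def using sum_squares_pos[OF fin u] by blast
  have cross: "(\<Sum>u\<in>V. \<Sum>v\<in>V. d u v * x u * r v) = (\<Sum>u\<in>V. \<Sum>v\<in>V. d u v * r u * x v)"
    by (subst sum.swap) (simp add: sym mult_ac)
  have c_eq: "c = (\<Sum>u\<in>V. \<Sum>v\<in>V. d u v * r u * x v) - \<mu> * (\<Sum>u\<in>V. r u * x u)"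
  proof -
    have "c = (\<Sum>u\<in>V. r u * ((\<Sum>v\<in>V. d u v * x v) - \<mu> * x u))"
      by (simp add: c_def r_def power2_eq_square)
    also have "\<dots> = (\<Sum>u\<in>V. (\<Sum>v\<in>V. d u v * r u * x v) - \<mu> * (r u * x u))"
      by (intro sum.cong refl) (simp add: algebra_simps sum_distrib_left)
    finally show ?thesis by (simp add: sum_subtractf sum_distrib_left)
  qed
  have ineq: "2 * t * c + t\<^sup>2 * K \<le> 0" for t
  proof -
    have "quad V d (\<lambda>v. x v + t * r v) = quad V d x
       + t * (\<Sum>u\<in>V. \<Sum>v\<in>V. d u v * x u * r v) + t * (\<Sum>u\<in>V. \<Sum>v\<in>V. d u v * r u * x v) + t\<^sup>2 * quad V d r"
      unfolding quad_def sum_distrib_left sum.distrib[symmetric]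
      by (intro sum.cong refl) (simp add: algebra_simps power2_eq_square)
    moreover have "(\<Sum>v\<in>V. (x v + t * r v)\<^sup>2)
        = (\<Sum>v\<in>V. (x v)\<^sup>2) + 2 * t * (\<Sum>v\<in>V. r v * x v) + t\<^sup>2 * (\<Sum>v\<in>V. (r v)\<^sup>2)"
      unfolding sum_distrib_left sum.distrib[symmetric]
      by (intro sum.cong refl) (simp add: algebra_simps power2_eq_square)
    ultimately have "2 * t * c + t\<^sup>2 * K
        = quad V d (\<lambda>v. x v + t * r v) - \<mu> * (\<Sum>v\<in>V. (x v + t * r v)\<^sup>2)"
      unfolding c_eq K_def cross max by (simp only:) (simp add: algebra_simps)
    then show ?thesis using bound[of "\<lambda>v. x v + t * r v"] by simp
  qed
  \<comment> \<open>The linear term wins for small \<open>t\<close>.\<close>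
  define t where "t = c / (\<bar>K\<bar> + 1)"
  have t: "t > 0" using c by (simp add: t_def add_nonneg_pos)
  have "c * \<bar>K\<bar> < 2 * c * (\<bar>K\<bar> + 1)"
    using c by (simp add: algebra_simps add_nonneg_pos)
  then have "t * \<bar>K\<bar> < 2 * c" by (simp add: t_def pos_divide_less_eq)
  then have "2 * c + t * K > 0"
    using t abs_ge_minus_self[of K] mult_left_mono[of "- K" "\<bar>K\<bar>" t] by simp
  then have "t * (2 * c + t * K) > 0" using t by simp
  with ineq[of t] show False by (simp add: algebra_simps power2_eq_square)
qed

text \<open>
  The form attains its maximum on the unit sphere, which is compact as a closed subset of a product
  of intervals. As \<open>d\<close> is nonnegative, replacing a maximiser by its absolute value does not lower the
  form, so there is a nonnegative maximiser.
\<close>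

lemma top_eigenvalue_exists:
  fixes V :: "'a set" and d :: "'a \<Rightarrow> 'a \<Rightarrow> real"
  assumes fin: "finite V" and ne: "V \<noteq> {}" and sym: "\<And>u v. d u v = d v u"
    and nonneg: "\<And>u v. 0 \<le> d u v"
  shows "\<exists>\<mu>. top_eigenvalue V d \<mu>"
proof -
  define K :: "('a \<Rightarrow> real) set"
    where "K = {x. (\<forall>v. v \<notin> V \<longrightarrow> x v = 0) \<and> (\<Sum>v\<in>V. (x v)\<^sup>2) = 1}"
  have coord: "x v \<in> {-1..1}" if "x \<in> K" for x v
  proof (cases "v \<in> V")
    case True
    have "(x v)\<^sup>2 \<le> (\<Sum>v\<in>V. (x v)\<^sup>2)" using True fin by (intro member_le_sum) auto
    then have "(x v)\<^sup>2 \<le> 1" using that by (simp add: K_def)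
    then have "\<bar>x v\<bar> \<le> 1" by (simp add: abs_square_le_1)
    then show ?thesis by (auto simp: abs_le_iff)
  next
    case False
    then show ?thesis using that by (simp add: K_def)
  qed
  have "compactin (product_topology (\<lambda>i. euclidean) UNIV) (PiE UNIV (\<lambda>_::'a. {-1..1::real}))"
    by (subst compactin_PiE) simp
  then have "compact (PiE UNIV (\<lambda>_::'a. {-1..1::real}))"
    by (simp add: euclidean_product_topology)
  moreover have "closed K"
  proof -
    have eq: "K = (\<Inter>v\<in>-V. {x. x v = 0}) \<inter> {x. (\<Sum>v\<in>V. (x v)\<^sup>2) = 1}"
      by (auto simp: K_def)
    show ?thesis unfolding eq
      by (intro closed_Int closed_INT ballI closed_Collect_eq continuous_intros
          continuous_on_product_coordinates)
  qed
  moreover have "K \<subseteq> PiE UNIV (\<lambda>_. {-1..1})" using coord by auto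
  ultimately have "compact K" by (metis compact_Int_closed inf.absorb_iff2)
  moreover have "K \<noteq> {}"
  proof -
    obtain v where v: "v \<in> V" using ne by blast
    have "(\<lambda>w. if w = v then 1 else 0) \<in> K"
      using v fin by (auto simp: K_def if_distrib[of "\<lambda>z. z\<^sup>2"] cong: if_cong)
    then show ?thesis by blast
  qed
  moreover have "continuous_on K (quad V d)"
    unfolding quad_def
    by (intro continuous_intros continuous_on_subset[OF continuous_on_product_coordinates]) auto
  ultimately obtain x where x: "x \<in> K" and xmax: "\<And>y. y \<in> K \<Longrightarrow> quad V d y \<le> quad V d x"
    using continuous_attains_sup[of K "quad V d"] by blast
  define \<mu> where "\<mu> = quad V d x"
  have bound: "quad V d y \<le> \<mu> * (\<Sum>v\<in>V. (y v)\<^sup>2)" for y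
  proof (cases "\<exists>v\<in>V. y v \<noteq> 0")
    case True
    define s where "s = sqrt (\<Sum>v\<in>V. (y v)\<^sup>2)"
    have s: "s > 0" and s2: "s\<^sup>2 = (\<Sum>v\<in>V. (y v)\<^sup>2)"
      using True sum_squares_pos[OF fin] by (auto simp: s_def sum_nonneg)
    define z where "z v = (if v \<in> V then y v / s else 0)" for v
    have "(\<Sum>v\<in>V. (z v)\<^sup>2) = (\<Sum>v\<in>V. (y v)\<^sup>2) / s\<^sup>2"
      by (simp add: z_def power_divide sum_divide_distrib)
    then have "z \<in> K" using s unfolding s2[symmetric] by (simp add: K_def z_def)
    then have "quad V d z \<le> \<mu>" using xmax \<mu>_def by blast
    moreover have "quad V d z = quad V d y / s\<^sup>2"
      by (simp add: quad_def z_def sum_divide_distrib power2_eq_square)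
    ultimately show ?thesis using s by (simp add: s2[symmetric] pos_divide_le_eq)
  next
    case False
    then show ?thesis by (simp add: quad_def)
  qed
  define z where "z v = \<bar>x v\<bar>" for v
  have z1: "(\<Sum>v\<in>V. (z v)\<^sup>2) = 1" using x by (simp add: K_def z_def)
  have "quad V d x \<le> quad V d z"
    unfolding quad_def z_def
  proof (intro sum_mono)
    fix u v
    have "d u v * (x u * x v) \<le> d u v * (\<bar>x u\<bar> * \<bar>x v\<bar>)"
      using nonneg by (intro mult_left_mono) (auto simp: abs_mult[symmetric])
    then show "d u v * x u * x v \<le> d u v * \<bar>x u\<bar> * \<bar>x v\<bar>" by (simp add: mult.assoc)
  qed
  then have "quad V d z = \<mu> * (\<Sum>v\<in>V. (z v)\<^sup>2)"
    using bound[of z] z1 by (simp add: \<mu>_def)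
  then have "\<forall>u\<in>V. (\<Sum>v\<in>V. d u v * z v) = \<mu> * z u"
    using maximiser_is_eigenvector[OF fin sym bound] by blast
  moreover have "\<exists>v\<in>V. z v \<noteq> 0"
    using z1 by (metis (mono_tags, lifting) sum.neutral zero_neq_one zero_power2)
  ultimately show ?thesis
    using bound unfolding top_eigenvalue_def
    by (intro exI[of _ \<mu>] conjI allI exI[of _ z]) (auto simp: z_def)
qed

text \<open>
  Any test vector bounds the largest eigenvalue from below. Equality would make it a maximiser and
  so an eigenvector, which fails at \<open>w\<close>.
\<close>

lemma top_eigenvalue_less:
  assumes fin: "finite V" and sym: "\<And>u v. d u v = d v u" and \<nu>: "top_eigenvalue V d \<nu>"
    and ge: "\<mu> * (\<Sum>v\<in>V. (x v)\<^sup>2) \<le> quad V d x"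
    and v: "v \<in> V" "x v \<noteq> 0"
    and w: "w \<in> V" "(\<Sum>v\<in>V. d w v * x v) \<noteq> \<mu> * x w"
  shows "\<mu> < \<nu>"
proof (rule ccontr)
  assume "\<not> \<mu> < \<nu>"
  have bound: "quad V d y \<le> \<nu> * (\<Sum>v\<in>V. (y v)\<^sup>2)" for y
    using \<nu> by (simp add: top_eigenvalue_def)
  have "\<mu> * (\<Sum>v\<in>V. (x v)\<^sup>2) \<le> \<nu> * (\<Sum>v\<in>V. (x v)\<^sup>2)" using ge bound[of x] by simp
  then have "\<mu> = \<nu>" using sum_squares_pos[OF fin v(1), of x] v(2) \<open>\<not> \<mu> < \<nu>\<close> by simp
  then have "quad V d x = \<nu> * (\<Sum>v\<in>V. (x v)\<^sup>2)" using ge bound[of x] by simp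
  from maximiser_is_eigenvector[OF fin sym bound this w(1)] show False
    using w(2) \<open>\<mu> = \<nu>\<close> by simp
qed

lemma perron_vector:
  assumes fin: "finite V" and two: "card V \<ge> 2" and \<mu>: "top_eigenvalue V d \<mu>"
    and pos: "\<And>u v. u \<in> V \<Longrightarrow> v \<in> V \<Longrightarrow> u \<noteq> v \<Longrightarrow> 0 < d u v"
    and nonneg: "\<And>u v. 0 \<le> d u v"
  shows "\<exists>x. 0 < \<mu> \<and> (\<forall>v\<in>V. 0 < x v) \<and> (\<forall>u\<in>V. (\<Sum>v\<in>V. d u v * x v) = \<mu> * x u)"
proof -
  obtain x v where x0: "\<forall>v\<in>V. 0 \<le> x v" and v: "v \<in> V" "x v \<noteq> 0"
    and ev: "\<forall>u\<in>V. (\<Sum>v\<in>V. d u v * x v) = \<mu> * x u"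
    using \<mu> unfolding top_eigenvalue_def by blast
  have xv: "x v > 0" using x0 v by (simp add: order_less_le)
  have prod: "0 < \<mu> * x u" if u: "u \<in> V" "u \<noteq> v" for u
  proof -
    have "0 < (\<Sum>v\<in>V. d u v * x v)"
      using fin v(1) pos[OF u(1) v(1) u(2)] xv nonneg x0
      by (intro sum_pos2[of V v]) auto
    then show ?thesis using ev u by simp
  qed
  obtain u where u: "u \<in> V" "u \<noteq> v"
    using two fin v(1) by (metis One_nat_def Suc_1 card_le_Suc0_iff_eq not_less_eq_eq)
  have "\<mu> > 0" using prod[OF u] x0 u by (metis mult_nonpos_nonneg not_le)
  moreover have "0 < x w" if "w \<in> V" for w
    using prod[of w] that xv \<open>\<mu> > 0\<close> by (cases "w = v") (auto simp: zero_less_mult_iff)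
  ultimately show ?thesis using ev by blast
qed

section \<open>Distances and trees\<close>

text \<open>
  Meaningful only if there is a walk from \<open>u\<close> to \<open>v\<close>; otherwise an unspecified number.
\<close>

definition gdist :: "'a rel \<Rightarrow> 'a \<Rightarrow> 'a \<Rightarrow> nat" where
  "gdist E u v = (LEAST k. (u, v) \<in> E ^^ k)"

definition sym_connected :: "'a set \<Rightarrow> 'a rel \<Rightarrow> bool" where
  "sym_connected V E \<longleftrightarrow> E \<subseteq> V \<times> V \<and> sym E \<and> (\<forall>u\<in>V. \<forall>v\<in>V. \<exists>k. (u, v) \<in> E ^^ k)"

lemma gdist_le: "(u, v) \<in> E ^^ k \<Longrightarrow> gdist E u v \<le> k"
  unfolding gdist_def by (rule Least_le)

lemma gdist_walk: "sym_connected V E \<Longrightarrow> u \<in> V \<Longrightarrow> v \<in> V \<Longrightarrow> (u, v) \<in> E ^^ gdist E u v"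
  unfolding gdist_def sym_connected_def by (metis (mono_tags, lifting) LeastI_ex)

lemma gdist_self [simp]: "gdist E u u = 0"
  using gdist_le[of u u 0 E] by simp

lemma relpow_converse:
  fixes E :: "'a rel"
  shows "(E ^^ k)\<inverse> = (E\<inverse>) ^^ k"
proof (induction k)
  case (Suc k)
  then show ?case by (simp only: relpow.simps converse_relcomp relpow_commute)
qed simp

lemma relpow_sym: "sym E \<Longrightarrow> (u, v) \<in> E ^^ k \<longleftrightarrow> (v, u) \<in> E ^^ k"
  by (metis converse_iff relpow_converse sym_conv_converse_eq)

lemma gdist_sym: "sym E \<Longrightarrow> gdist E u v = gdist E v u"
  unfolding gdist_def by (simp add: relpow_sym)

lemma gdist_edge_le:
  assumes "sym_connected V E" "u \<in> V" "(v, w) \<in> E"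
  shows "gdist E u w \<le> Suc (gdist E u v)"
proof -
  have "v \<in> V" using assms by (auto simp: sym_connected_def)
  then show ?thesis using gdist_walk[OF assms(1,2)] assms(3) by (intro gdist_le) auto
qed

lemma gdist_pos:
  assumes "sym_connected V E" "u \<in> V" "v \<in> V" "u \<noteq> v"
  shows "0 < gdist E u v"
  using gdist_walk[OF assms(1,2,3)] assms(4) by (cases "gdist E u v") auto

text \<open>
  A function that grows by at most one along every edge is a lower bound for the distance from its
  zero. Distances are computed below by guessing such a function and exhibiting a walk.
\<close>

lemma gdist_ge_potential:
  assumes g: "\<And>y z. (y, z) \<in> E \<Longrightarrow> g z \<le> Suc (g y)" and "g u = (0::nat)" and "(u, v) \<in> E ^^ k"
  shows "g v \<le> k"
  using assms(3)
proof (induction k arbitrary: v)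
  case (Suc k)
  then obtain w where "(u, w) \<in> E ^^ k" "(w, v) \<in> E" by auto
  then show ?case using Suc.IH[of w] g[of w v] by simp
qed (use assms in simp)

lemma relpow_mono:
  fixes E F :: "'a rel"
  assumes "E \<subseteq> F"
  shows "E ^^ k \<subseteq> F ^^ k"
  using assms by (induction k) (auto simp: relcomp_mono)

lemma gdist_mono:
  assumes "sym_connected V E" "E \<subseteq> F" "u \<in> V" "v \<in> V"
  shows "gdist F u v \<le> gdist E u v"
  using gdist_walk[OF assms(1,3,4)] relpow_mono[OF assms(2)] by (intro gdist_le) blast

definition bridge :: "'a \<Rightarrow> 'a \<Rightarrow> 'a rel" where
  "bridge a b = {(a, b), (b, a)}"

lemma bridge_commute: "bridge a b = bridge b a"
  by (auto simp: bridge_def)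

lemma gdist_bridge:
  assumes J1: "sym_connected V1 E1" and J2: "sym_connected V2 E2" and disj: "V1 \<inter> V2 = {}"
    and a: "a \<in> V1" and b: "b \<in> V2" and u: "u \<in> V1" and z: "z \<in> V1 \<union> V2"
    and E: "E = E1 \<union> E2 \<union> bridge a b"
  shows "gdist E u z = (if z \<in> V1 then gdist E1 u z else gdist E1 u a + 1 + gdist E2 b z)"
    and "(u, z) \<in> E ^^ (if z \<in> V1 then gdist E1 u z else gdist E1 u a + 1 + gdist E2 b z)"
proof -
  define g where "g z = (if z \<in> V1 then gdist E1 u z else gdist E1 u a + 1 + gdist E2 b z)" for z
  have sub: "E1 \<subseteq> V1 \<times> V1" "E2 \<subseteq> V2 \<times> V2" using J1 J2 by (auto simp: sym_connected_def)
  have mono: "E1 ^^ k \<subseteq> E ^^ k" "E2 ^^ k \<subseteq> E ^^ k" for k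
    unfolding E by (auto intro!: relpow_mono)
  show walk: "(u, z) \<in> E ^^ (if z \<in> V1 then gdist E1 u z else gdist E1 u a + 1 + gdist E2 b z)"
  proof (cases "z \<in> V1")
    case True
    then show ?thesis using gdist_walk[OF J1 u] mono by auto
  next
    case False
    then have "(b, z) \<in> E ^^ gdist E2 b z" using gdist_walk[OF J2 b] z mono by blast
    moreover have "(u, a) \<in> E ^^ gdist E1 u a" using gdist_walk[OF J1 u a] mono by blast
    moreover have "(a, b) \<in> E ^^ 1" by (simp add: E bridge_def)
    ultimately show ?thesis using False by (auto simp only: relpow_add if_False)
  qed
  have lip: "g y' \<le> Suc (g y)" if "(y, y') \<in> E" for y y'
  proof -
    consider "(y, y') \<in> E1" | "(y, y') \<in> E2" | "y = a" "y' = b" | "y = b" "y' = a"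
      using \<open>(y, y') \<in> E\<close> unfolding E bridge_def by blast
    then show ?thesis
    proof cases
      case 1
      then show ?thesis using sub gdist_edge_le[OF J1 u 1] by (auto simp: g_def)
    next
      case 2
      then have "y \<notin> V1" "y' \<notin> V1" using sub disj by auto
      then show ?thesis using gdist_edge_le[OF J2 b 2] by (auto simp: g_def)
    next
      case 3
      then show ?thesis using a b disj by (auto simp: g_def)
    next
      case 4
      then have "y \<notin> V1" using b disj by blast
      then show ?thesis using 4 a by (auto simp: g_def)
    qed
  qed
  have "g u = 0" using u by (simp add: g_def)
  from gdist_ge_potential[of E g, OF lip this]
  have "g z \<le> k" if "(u, z) \<in> E ^^ k" for k using that by blast
  then show "gdist E u z = (if z \<in> V1 then gdist E1 u z else gdist E1 u a + 1 + gdist E2 b z)"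
    using walk unfolding g_def[symmetric] gdist_def[of E] by (intro Least_equality)
qed

text \<open>
  Joining two trees by an edge, rather than adding leaves, makes the class visibly closed under
  detaching a branch and attaching it elsewhere.
\<close>

inductive is_tree :: "'a set \<Rightarrow> 'a rel \<Rightarrow> bool" where
  single: "is_tree {v} {}"
| join: "is_tree V1 E1 \<Longrightarrow> is_tree V2 E2 \<Longrightarrow> V1 \<inter> V2 = {} \<Longrightarrow> a \<in> V1 \<Longrightarrow> b \<in> V2
    \<Longrightarrow> is_tree (V1 \<union> V2) (E1 \<union> E2 \<union> bridge a b)"

lemma sym_connected_bridge:
  assumes J1: "sym_connected V1 E1" and J2: "sym_connected V2 E2" and disj: "V1 \<inter> V2 = {}"
    and a: "a \<in> V1" and b: "b \<in> V2"
  shows "sym_connected (V1 \<union> V2) (E1 \<union> E2 \<union> bridge a b)"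
  unfolding sym_connected_def
proof (intro conjI ballI)
  show "E1 \<union> E2 \<union> bridge a b \<subseteq> (V1 \<union> V2) \<times> (V1 \<union> V2)"
    using J1 J2 a b by (auto simp: sym_connected_def bridge_def)
  show "sym (E1 \<union> E2 \<union> bridge a b)"
    using J1 J2 by (auto simp: sym_connected_def bridge_def sym_def)
  fix u z assume uz: "u \<in> V1 \<union> V2" "z \<in> V1 \<union> V2"
  show "\<exists>k. (u, z) \<in> (E1 \<union> E2 \<union> bridge a b) ^^ k"
  proof (cases "u \<in> V1")
    case True
    then show ?thesis using gdist_bridge(2)[OF J1 J2 disj a b _ uz(2) refl] by blast
  next
    case False
    then have "u \<in> V2" "V2 \<inter> V1 = {}" "z \<in> V2 \<union> V1"
      "E1 \<union> E2 \<union> bridge a b = E2 \<union> E1 \<union> bridge b a"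
      using uz disj by (auto simp: bridge_def)
    then show ?thesis using gdist_bridge(2)[OF J2 J1 _ b a] by metis
  qed
qed

lemma is_tree_sym_connected: "is_tree V E \<Longrightarrow> sym_connected V E"
proof (induction rule: is_tree.induct)
  case (single v)
  have "(v, v) \<in> {} ^^ 0" by simp
  then show ?case unfolding sym_connected_def sym_def by blast
qed (simp add: sym_connected_bridge)

lemma is_tree_finite: "is_tree V E \<Longrightarrow> finite V \<and> V \<noteq> {}"
  by (induction rule: is_tree.induct) auto

lemma is_tree_irrefl: "is_tree V E \<Longrightarrow> (v, v) \<notin> E"
  by (induction rule: is_tree.induct) (auto simp: bridge_def)

lemma is_tree_sub: "is_tree V E \<Longrightarrow> E \<subseteq> V \<times> V" and is_tree_sym: "is_tree V E \<Longrightarrow> sym E"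
  using is_tree_sym_connected unfolding sym_connected_def by blast+

lemma is_tree_edges_finite: "is_tree V E \<Longrightarrow> finite E"
  using is_tree_sub is_tree_finite by (metis finite_SigmaI finite_subset)

text \<open>
  Every edge can serve as the last one joined: an edge inside one of the two parts splits that part,
  and the old joining edge reconnects the half that contains its endpoint.
\<close>

lemma is_tree_split:
  assumes "is_tree V E" "(a, b) \<in> E"
  obtains V1 E1 V2 E2 where "is_tree V1 E1" "is_tree V2 E2" "V1 \<inter> V2 = {}" "a \<in> V1" "b \<in> V2"
    "V = V1 \<union> V2" "E = E1 \<union> E2 \<union> bridge a b"
proof -
  have "\<exists>V1 E1 V2 E2. is_tree V1 E1 \<and> is_tree V2 E2 \<and> V1 \<inter> V2 = {} \<and> a \<in> V1 \<and> b \<in> V2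
    \<and> V = V1 \<union> V2 \<and> E = E1 \<union> E2 \<union> bridge a b"
    using assms
  proof (induction arbitrary: a b rule: is_tree.induct)
    case (join V1 E1 V2 E2 c d)
    have *: "\<exists>W1 F1 W2 F2. is_tree W1 F1 \<and> is_tree W2 F2 \<and> W1 \<inter> W2 = {} \<and> a \<in> W1 \<and> b \<in> W2
      \<and> V1 \<union> V2 = W1 \<union> W2 \<and> E1 \<union> E2 \<union> bridge c d = F1 \<union> F2 \<union> bridge a b"
      if IH: "\<exists>W1 F1 W2 F2. is_tree W1 F1 \<and> is_tree W2 F2 \<and> W1 \<inter> W2 = {} \<and> a \<in> W1 \<and> b \<in> W2
        \<and> V1 = W1 \<union> W2 \<and> E1 = F1 \<union> F2 \<union> bridge a b"
        and t: "is_tree V2 E2" "V1 \<inter> V2 = {}" "c \<in> V1" "d \<in> V2" for V1 E1 V2 E2 c d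
    proof -
      obtain W1 F1 W2 F2 where W: "is_tree W1 F1" "is_tree W2 F2" "W1 \<inter> W2 = {}" "a \<in> W1" "b \<in> W2"
        "V1 = W1 \<union> W2" "E1 = F1 \<union> F2 \<union> bridge a b" using IH by blast
      show ?thesis
      proof (cases "c \<in> W1")
        case True
        have "is_tree (W1 \<union> V2) (F1 \<union> E2 \<union> bridge c d)"
          by (rule is_tree.join) (use W t True in auto)
        moreover have "(W1 \<union> V2) \<inter> W2 = {}" using W(3,6) t(2) by blast
        moreover have "a \<in> W1 \<union> V2" "V1 \<union> V2 = (W1 \<union> V2) \<union> W2" using W(4,6) by auto
        moreover have "E1 \<union> E2 \<union> bridge c d = (F1 \<union> E2 \<union> bridge c d) \<union> F2 \<union> bridge a b"
          unfolding W(7) by (simp only: Un_ac)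
        ultimately show ?thesis using W(2,5) by (intro exI conjI)
      next
        case False
        have "is_tree (W2 \<union> V2) (F2 \<union> E2 \<union> bridge c d)"
          by (rule is_tree.join) (use W t False in auto)
        moreover have "W1 \<inter> (W2 \<union> V2) = {}" using W(3,6) t(2) by blast
        moreover have "b \<in> W2 \<union> V2" "V1 \<union> V2 = W1 \<union> (W2 \<union> V2)" using W(5,6) by auto
        moreover have "E1 \<union> E2 \<union> bridge c d = F1 \<union> (F2 \<union> E2 \<union> bridge c d) \<union> bridge a b"
          unfolding W(7) by (simp only: Un_ac)
        ultimately show ?thesis using W(1,4) by (intro exI conjI)
      qed
    qed
    consider "(a, b) \<in> E1" | "(a, b) \<in> E2" | "a = c" "b = d" | "a = d" "b = c"
      using join.prems by (auto simp: bridge_def)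
    then show ?case
    proof cases
      case 1
      then show ?thesis using *[OF join.IH(1)[OF 1] join.hyps(2,3,4,5)] by simp
    next
      case 2
      have "V2 \<inter> V1 = {}" using join.hyps by blast
      then show ?thesis using *[OF join.IH(2)[OF 2] join.hyps(1) _ join.hyps(5,4)]
        by (simp add: Un_commute bridge_commute)
    next
      case 3
      then show ?thesis using join.hyps by blast
    next
      case 4
      then show ?thesis using join.hyps
        by (intro exI[of _ V2] exI[of _ E2] exI[of _ V1] exI[of _ E1]) (auto simp: bridge_def)
    qed
  qed simp
  then show ?thesis using that by blast
qed

section \<open>The distance spectral radius on a vertex set\<close>

abbreviation rdist :: "'a rel \<Rightarrow> 'a \<Rightarrow> 'a \<Rightarrow> real" where
  "rdist E u v \<equiv> real (gdist E u v)"

definition radius :: "'a set \<Rightarrow> 'a rel \<Rightarrow> real" where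
  "radius V E = (THE \<mu>. top_eigenvalue V (rdist E) \<mu>)"

lemma radius_top_eigenvalue:
  assumes "finite V" "V \<noteq> {}" "sym E"
  shows "top_eigenvalue V (rdist E) (radius V E)"
proof -
  have "rdist E u v = rdist E v u" for u v using gdist_sym[OF assms(3)] by simp
  then obtain \<mu> where \<mu>: "top_eigenvalue V (rdist E) \<mu>"
    using top_eigenvalue_exists[OF assms(1,2), of "rdist E"] by auto
  have "radius V E = \<mu>"
    unfolding radius_def using \<mu> top_eigenvalue_unique[OF assms(1) _ \<mu>] by (rule the_equality)
  with \<mu> show ?thesis by simp
qed

lemma radius_eqI: "finite V \<Longrightarrow> top_eigenvalue V (rdist E) \<mu> \<Longrightarrow> radius V E = \<mu>"
  unfolding radius_def using top_eigenvalue_unique[of V] by blast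

lemma radius_mono:
  assumes fin: "finite V" "V \<noteq> {}" and sym: "sym E" "sym F"
    and le: "\<And>u v. u \<in> V \<Longrightarrow> v \<in> V \<Longrightarrow> gdist E u v \<le> gdist F u v"
  shows "radius V E \<le> radius V F"
proof -
  obtain x v where x0: "\<forall>v\<in>V. 0 \<le> x v" and v: "v \<in> V" "x v \<noteq> 0"
    and ev: "\<forall>u\<in>V. (\<Sum>v\<in>V. rdist E u v * x v) = radius V E * x u"
    using radius_top_eigenvalue[OF fin sym(1)] unfolding top_eigenvalue_def by blast
  have "radius V E * (\<Sum>v\<in>V. (x v)\<^sup>2) = quad V (rdist E) x"
    using quad_eigenvector[OF ev] by simp
  also have "\<dots> \<le> quad V (rdist F) x"
    unfolding quad_def using le x0 by (intro sum_mono mult_right_mono) auto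
  also have "\<dots> \<le> radius V F * (\<Sum>v\<in>V. (x v)\<^sup>2)"
    using radius_top_eigenvalue[OF fin sym(2)] by (simp add: top_eigenvalue_def)
  finally show ?thesis using sum_squares_pos[OF fin(1) v(1), of x] v(2) by simp
qed

lemma radius_less:
  assumes fin: "finite V" "V \<noteq> {}" and sym: "sym F"
    and ge: "\<mu> * (\<Sum>v\<in>V. (x v)\<^sup>2) \<le> quad V (rdist F) x"
    and "v \<in> V" "x v \<noteq> 0"
    and "w \<in> V" "(\<Sum>v\<in>V. rdist F w v * x v) \<noteq> \<mu> * x w"
  shows "\<mu> < radius V F"
  using assms gdist_sym[OF sym]
  by (intro top_eigenvalue_less[OF fin(1) _ radius_top_eigenvalue[OF fin sym] ge, of v w]) auto

lemma sym_connected_perron_vector: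
  assumes "finite V" "card V \<ge> 2" "sym_connected V E"
  shows "\<exists>x. 0 < radius V E \<and> (\<forall>v\<in>V. 0 < x v) \<and>
    (\<forall>u\<in>V. (\<Sum>v\<in>V. rdist E u v * x v) = radius V E * x u)"
proof -
  have "V \<noteq> {}" "sym E" using assms by (auto simp: sym_connected_def)
  then show ?thesis
    using perron_vector[OF assms(1,2) radius_top_eigenvalue[OF assms(1)], of E]
      gdist_pos[OF assms(3)] by auto
qed

lemma gdist_join:
  assumes T1: "is_tree V1 E1" and T2: "is_tree V2 E2" and disj: "V1 \<inter> V2 = {}"
    and a: "a \<in> V1" and b: "b \<in> V2"
  defines "E \<equiv> E1 \<union> E2 \<union> bridge a b"
  shows "u \<in> V1 \<Longrightarrow> v \<in> V1 \<Longrightarrow> gdist E u v = gdist E1 u v"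
    and "u \<in> V2 \<Longrightarrow> v \<in> V2 \<Longrightarrow> gdist E u v = gdist E2 u v"
    and "u \<in> V1 \<Longrightarrow> v \<in> V2 \<Longrightarrow> gdist E u v = gdist E1 u a + 1 + gdist E2 b v"
    and "u \<in> V1 \<Longrightarrow> v \<in> V2 \<Longrightarrow> gdist E v u = gdist E1 u a + 1 + gdist E2 b v"
proof -
  note J = is_tree_sym_connected[OF T1] is_tree_sym_connected[OF T2]
  show "gdist E u v = gdist E1 u v" if "u \<in> V1" "v \<in> V1"
    using gdist_bridge(1)[OF J disj a b, of u v E] that by (simp add: E_def)
  show "gdist E u v = gdist E2 u v" if "u \<in> V2" "v \<in> V2"
    using gdist_bridge(1)[OF J(2,1) _ b a, of u v E] that disj
    by (auto simp: E_def bridge_commute Un_commute)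
  show *: "gdist E u v = gdist E1 u a + 1 + gdist E2 b v" if "u \<in> V1" "v \<in> V2"
  proof -
    have "v \<notin> V1" using that disj by blast
    then show ?thesis using gdist_bridge(1)[OF J disj a b, of u v E] that by (simp add: E_def)
  qed
  have "sym E" unfolding E_def by (rule is_tree_sym[OF is_tree.join[OF T1 T2 disj a b]])
  then show "gdist E v u = gdist E1 u a + 1 + gdist E2 b v" if "u \<in> V1" "v \<in> V2"
    using *[OF that] gdist_sym by metis
qed

text \<open>
  Joining leaves the distances inside \<open>V1\<close> unchanged, so the Perron vector of the part, extended by
  zero, gives the same value of the form. It is no eigenvector of the whole: it vanishes at \<open>b\<close>, where
  its image is positive.
\<close>

lemma radius_less_join:
  assumes T1: "is_tree V1 E1" and T2: "is_tree V2 E2" and disj: "V1 \<inter> V2 = {}"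
    and a: "a \<in> V1" and b: "b \<in> V2"
  shows "radius V1 E1 < radius (V1 \<union> V2) (E1 \<union> E2 \<union> bridge a b)"
proof -
  define E where "E = E1 \<union> E2 \<union> bridge a b"
  have T: "is_tree (V1 \<union> V2) E" unfolding E_def by (rule is_tree.join[OF assms])
  have fin: "finite V1" "V1 \<noteq> {}" "finite V2" using T1 T2 is_tree_finite by auto
  obtain x v where x0: "\<forall>v\<in>V1. 0 \<le> x v" and v: "v \<in> V1" "x v \<noteq> 0"
    and ev: "\<forall>u\<in>V1. (\<Sum>v\<in>V1. rdist E1 u v * x v) = radius V1 E1 * x u"
    using radius_top_eigenvalue[OF fin(1,2) is_tree_sym[OF T1]] unfolding top_eigenvalue_def by blast
  define y where "y v = (if v \<in> V1 then x v else 0)" for v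
  have restrict: "(\<Sum>v\<in>V1 \<union> V2. f v) = (\<Sum>v\<in>V1. f v)" if "\<And>v. v \<notin> V1 \<Longrightarrow> f v = 0" for f :: "'a \<Rightarrow> real"
    using that fin by (intro sum.mono_neutral_right) auto
  have "quad (V1 \<union> V2) (rdist E) y = (\<Sum>u\<in>V1. \<Sum>v\<in>V1 \<union> V2. rdist E u v * y u * y v)"
    unfolding quad_def by (subst restrict) (auto simp: y_def)
  also have "\<dots> = (\<Sum>u\<in>V1. \<Sum>v\<in>V1. rdist E u v * y u * y v)"
    by (rule sum.cong[OF refl], rule restrict) (simp add: y_def)
  also have "\<dots> = quad V1 (rdist E1) x"
    unfolding quad_def using gdist_join(1)[OF assms] by (intro sum.cong refl) (auto simp: y_def E_def)
  finally have "quad (V1 \<union> V2) (rdist E) y = quad V1 (rdist E1) x" .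
  moreover have "(\<Sum>v\<in>V1 \<union> V2. (y v)\<^sup>2) = (\<Sum>v\<in>V1. (x v)\<^sup>2)"
    by (subst restrict) (auto simp: y_def intro!: sum.cong)
  ultimately have q: "radius V1 E1 * (\<Sum>v\<in>V1 \<union> V2. (y v)\<^sup>2) \<le> quad (V1 \<union> V2) (rdist E) y"
    using quad_eigenvector[OF ev] by simp
  have "0 < (\<Sum>v\<in>V1. rdist E b v * x v)"
    using v x0 fin gdist_join(4)[OF assms v(1) b]
    by (intro sum_pos2[of V1 v]) (auto simp: E_def order_less_le)
  also have "\<dots> = (\<Sum>v\<in>V1 \<union> V2. rdist E b v * y v)"
    by (subst restrict) (auto simp: y_def)
  finally have "(\<Sum>v\<in>V1 \<union> V2. rdist E b v * y v) \<noteq> radius V1 E1 * y b"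
    using b disj by (auto simp: y_def)
  then show ?thesis
    unfolding E_def[symmetric] using v fin q b
    by (intro radius_less[where x = y and v = v and w = b, OF _ _ is_tree_sym[OF T]])
      (auto simp: y_def)
qed

section \<open>Moving a branch along an edge\<close>

text \<open>
  In a tree, if \<open>c\<close> is a neighbour of \<open>u\<close>, this is the component of \<open>c\<close> after removing the edge
  between \<open>u\<close> and \<open>c\<close>.
\<close>

definition branch :: "'a set \<Rightarrow> 'a rel \<Rightarrow> 'a \<Rightarrow> 'a \<Rightarrow> 'a set" where
  "branch V E u c = {y \<in> V. gdist E c y < gdist E u y}"

definition move :: "'a rel \<Rightarrow> 'a \<Rightarrow> 'a \<Rightarrow> 'a \<Rightarrow> 'a rel" where
  "move E u j i = (E - bridge u j) \<union> bridge i j"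

lemma tree_split_branch:
  assumes T: "is_tree V E" and e: "(u, c) \<in> E"
  obtains V1 E1 V2 E2 where "is_tree V1 E1" "is_tree V2 E2" "V1 \<inter> V2 = {}" "u \<in> V1" "c \<in> V2"
    "V = V1 \<union> V2" "E = E1 \<union> E2 \<union> bridge u c" "branch V E u c = V2"
proof -
  obtain V1 E1 V2 E2 where S: "is_tree V1 E1" "is_tree V2 E2" "V1 \<inter> V2 = {}" "u \<in> V1" "c \<in> V2"
    and V: "V = V1 \<union> V2" and E: "E = E1 \<union> E2 \<union> bridge u c"
    using is_tree_split[OF T e] by blast
  have "gdist E c y < gdist E u y" if "y \<in> V2" for y
    using gdist_join(2,3)[OF S, of _ y] S that by (simp add: E)
  moreover have "\<not> gdist E c y < gdist E u y" if "y \<in> V1" for y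
    using gdist_join(1)[OF S S(4) that] gdist_join(4)[OF S that S(5)]
      gdist_sym[OF is_tree_sym[OF S(1)], of u y] by (simp add: E)
  ultimately have "branch V E u c = V2" unfolding branch_def V by blast
  then show ?thesis using S V E that by blast
qed

lemma edge_gdist:
  assumes "is_tree V E" "(u, c) \<in> E"
  shows "y \<in> branch V E u c \<Longrightarrow> gdist E u y = Suc (gdist E c y)"
    and "y \<in> V - branch V E u c \<Longrightarrow> gdist E c y = Suc (gdist E u y)"
proof -
  obtain V1 E1 V2 E2 where S: "is_tree V1 E1" "is_tree V2 E2" "V1 \<inter> V2 = {}" "u \<in> V1" "c \<in> V2"
    and V: "V = V1 \<union> V2" and E: "E = E1 \<union> E2 \<union> bridge u c" and B: "branch V E u c = V2"
    using tree_split_branch[OF assms] by blast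
  show "gdist E u y = Suc (gdist E c y)" if "y \<in> branch V E u c"
    using gdist_join(2,3)[OF S, of _ y] S that by (simp add: E B[unfolded E])
  show "gdist E c y = Suc (gdist E u y)" if "y \<in> V - branch V E u c"
  proof -
    have y: "y \<in> V1" using that unfolding V B[unfolded V] by blast
    show ?thesis
      using gdist_join(1)[OF S S(4) y] gdist_join(4)[OF S y S(5)]
        gdist_sym[OF is_tree_sym[OF S(1)], of u y] by (simp add: E)
  qed
qed

lemma branches_disjoint:
  assumes T: "is_tree V E" and e: "(u, c) \<in> E" "(u, c') \<in> E" and ne: "c \<noteq> c'"
  shows "branch V E u c \<inter> branch V E u c' = {}"
proof -
  obtain V1 E1 V2 E2 where S: "is_tree V1 E1" "is_tree V2 E2" "V1 \<inter> V2 = {}" "u \<in> V1" "c \<in> V2"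
    and V: "V = V1 \<union> V2" and E: "E = E1 \<union> E2 \<union> bridge u c" and B: "branch V E u c = V2"
    using tree_split_branch[OF T e(1)] by blast
  have c': "c' \<in> V1"
    using e(2) ne S(3,4) is_tree_sub[OF S(1)] is_tree_sub[OF S(2)] unfolding E bridge_def by auto
  have "\<not> gdist E c' y < gdist E u y" if "y \<in> V2" for y
    using gdist_join(3)[OF S S(4) that] gdist_join(3)[OF S c' that] by (simp add: E)
  then show ?thesis unfolding B by (auto simp: branch_def)
qed

lemma branches_cover:
  assumes T: "is_tree V E" and y: "u \<in> V" "y \<in> V" "y \<noteq> u"
  obtains c where "(u, c) \<in> E" "y \<in> branch V E u c"
proof -
  note J = is_tree_sym_connected[OF T]
  obtain k where k: "gdist E u y = Suc k"
    using gdist_pos[OF J y(1,2)] y(3) by (metis gr0_conv_Suc)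
  then have "(u, y) \<in> E ^^ Suc k" using gdist_walk[OF J y(1,2)] by simp
  then obtain c where c: "(u, c) \<in> E" "(c, y) \<in> E ^^ k" by (metis relpow_Suc_E2)
  then show ?thesis using gdist_le[OF c(2)] k y that[of c] by (simp add: branch_def)
qed

lemma branch_sub: "branch V E u c \<subseteq> V - {u}"
  by (auto simp: branch_def)

lemma branch_self: "is_tree V E \<Longrightarrow> (u, c) \<in> E \<Longrightarrow> c \<in> branch V E u c"
  using tree_split_branch by metis

lemma branch_rest:
  assumes T: "is_tree V E" and e: "(u, c) \<in> E"
  shows "branch V E u c = V - {u} - (\<Union>c'\<in>E `` {u} - {c}. branch V E u c')" (is "?L = ?R")
proof
  show "?L \<subseteq> ?R" using branches_disjoint[OF T e] branch_sub[of V E u] by blast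
  show "?R \<subseteq> ?L"
  proof
    fix y assume y: "y \<in> ?R"
    have "u \<in> V" using e is_tree_sub[OF T] by blast
    then obtain c' where "(u, c') \<in> E" "y \<in> branch V E u c'" using branches_cover[OF T, of u y] y by blast
    then show "y \<in> ?L" using y by (cases "c' = c") auto
  qed
qed

lemma branchD: "y \<in> branch V E u c \<Longrightarrow> y \<in> V" "y \<in> branch V E u c \<Longrightarrow> y \<noteq> u"
  by (auto simp: branch_def)

lemma branch_leaf:
  assumes T: "is_tree V E" and leaf: "E `` {j} = {u}"
  shows "branch V E u j = {j}"
proof -
  have "(u, j) \<in> E" using leaf is_tree_sym[OF T] by (auto simp: sym_def)
  moreover have "y = j" if y: "y \<in> branch V E u j" for y
  proof (rule ccontr)
    assume "y \<noteq> j"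
    moreover have "j \<in> V" using leaf is_tree_sub[OF T] by blast
    ultimately obtain c where c: "(j, c) \<in> E" "y \<in> branch V E j c"
      using branches_cover[OF T _ branchD(1)[OF y]] by metis
    moreover from c(1) have "c = u" using leaf by blast
    ultimately show False using y by (simp add: branch_def)
  qed
  ultimately show ?thesis using branch_self[OF T] by blast
qed

lemma quad_Un:
  assumes "finite A" "finite B" "A \<inter> B = {}" "\<And>u v. d u v = d v u"
  shows "quad (A \<union> B) d x = quad A d x + quad B d x + 2 * (\<Sum>u\<in>A. \<Sum>v\<in>B. d u v * x u * x v)"
proof -
  have "(\<Sum>u\<in>B. \<Sum>v\<in>A. d u v * x u * x v) = (\<Sum>u\<in>A. \<Sum>v\<in>B. d u v * x u * x v)"
    by (subst sum.swap) (simp add: assms(4) mult_ac)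
  then show ?thesis
    using assms(1-3) by (simp add: quad_def sum.union_disjoint sum.distrib)
qed

lemma quad_join:
  assumes S: "is_tree V1 E1" "is_tree V2 E2" "V1 \<inter> V2 = {}" "a \<in> V1" "b \<in> V2"
  shows "quad (V1 \<union> V2) (rdist (E1 \<union> E2 \<union> bridge a b)) x
    = quad V1 (rdist E1) x + quad V2 (rdist E2) x
      + 2 * ((\<Sum>y\<in>V1. rdist E1 y a * x y) * sum x V2
             + sum x V1 * (\<Sum>z\<in>V2. (1 + rdist E2 b z) * x z))"
proof -
  let ?E = "E1 \<union> E2 \<union> bridge a b"
  have fin: "finite V1" "finite V2" using S is_tree_finite by auto
  have sym: "rdist ?E u v = rdist ?E v u" for u v
    using gdist_sym[OF is_tree_sym[OF is_tree.join[OF S]]] by simp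
  have "quad V1 (rdist ?E) x = quad V1 (rdist E1) x"
    unfolding quad_def by (intro sum.cong refl) (simp add: gdist_join(1)[OF S])
  moreover have "quad V2 (rdist ?E) x = quad V2 (rdist E2) x"
    unfolding quad_def by (intro sum.cong refl) (simp add: gdist_join(2)[OF S])
  moreover have "(\<Sum>u\<in>V1. \<Sum>v\<in>V2. rdist ?E u v * x u * x v)
    = (\<Sum>u\<in>V1. \<Sum>v\<in>V2. (rdist E1 u a * x u) * x v + x u * ((1 + rdist E2 b v) * x v))"
    by (intro sum.cong refl) (simp add: gdist_join(3)[OF S] algebra_simps)
  ultimately show ?thesis
    unfolding quad_Un[OF fin S(3) sym] by (simp add: sum.distrib sum_product)
qed

text \<open>
  Both trees join the same two parts, at \<open>u\<close> and at \<open>i\<close> respectively. So only the distances between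
  the parts differ, and for a vertex \<open>y\<close> of the part of \<open>u\<close> the difference of the distances to \<open>i\<close>
  and to \<open>u\<close> is \<open>-1\<close> on the branch of \<open>i\<close> and \<open>1\<close> elsewhere.
\<close>

lemma move_tree:
  assumes T: "is_tree V E" and e: "(u, i) \<in> E" "(u, j) \<in> E" and ne: "i \<noteq> j"
  shows "is_tree V (move E u j i)"
    and "(i, j) \<notin> E"
    and "quad V (rdist (move E u j i)) x = quad V (rdist E) x + 2 * sum x (branch V E u j)
       * (sum x V - sum x (branch V E u j) - 2 * sum x (branch V E u i))"
proof -
  obtain V1 E1 V2 E2 where S: "is_tree V1 E1" "is_tree V2 E2" "V1 \<inter> V2 = {}" "u \<in> V1" "j \<in> V2"
    and V: "V = V1 \<union> V2" and E: "E = E1 \<union> E2 \<union> bridge u j" and B: "branch V E u j = V2"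
    using tree_split_branch[OF T e(2)] by blast
  have sub: "E1 \<subseteq> V1 \<times> V1" "E2 \<subseteq> V2 \<times> V2" using S is_tree_sub by auto
  have e1: "(u, i) \<in> E1" using e(1) ne S(3,4) sub unfolding E bridge_def by auto
  then have i: "i \<in> V1" using sub by blast
  have S': "is_tree V1 E1" "is_tree V2 E2" "V1 \<inter> V2 = {}" "i \<in> V1" "j \<in> V2" using S i by auto
  have F: "move E u j i = E1 \<union> E2 \<union> bridge i j"
    using sub S(3-5) unfolding move_def E bridge_def by auto
  show "is_tree V (move E u j i)" unfolding F V by (rule is_tree.join[OF S'])
  show "(i, j) \<notin> E" using e1 is_tree_irrefl[OF S(1)] sub S(3-5) i unfolding E bridge_def by auto
  have fin: "finite V1" "finite V2" using S is_tree_finite by auto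
  have W: "branch V E u i = branch V1 E1 u i"
  proof -
    have d: "gdist E i y < gdist E u y \<longleftrightarrow> gdist E1 i y < gdist E1 u y" if "y \<in> V1" for y
      using gdist_join(1)[OF S i that] gdist_join(1)[OF S S(4) that] by (simp add: E)
    have "y \<in> V1" if "y \<in> branch V E u i" for y
      using branches_disjoint[OF T e ne] that B V branchD(1)[OF that] by blast
    then have "branch V E u i = {y \<in> V1. gdist E i y < gdist E u y}"
      unfolding branch_def V by blast
    also have "\<dots> = branch V1 E1 u i" unfolding branch_def using d by blast
    finally show ?thesis .
  qed
  have shift: "(\<Sum>y\<in>V1. rdist E1 y i * x y) - (\<Sum>y\<in>V1. rdist E1 y u * x y)
      = sum x V1 - 2 * sum x (branch V1 E1 u i)"
  proof -
    have d: "rdist E1 y i - rdist E1 y u = 1 - 2 * of_bool (y \<in> branch V1 E1 u i)" if "y \<in> V1" for y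
      using edge_gdist[OF S(1) e1, of y] that gdist_sym[OF is_tree_sym[OF S(1)], of y] by auto
    have "(\<Sum>y\<in>V1. rdist E1 y i * x y) - (\<Sum>y\<in>V1. rdist E1 y u * x y)
      = (\<Sum>y\<in>V1. (rdist E1 y i - rdist E1 y u) * x y)"
      by (simp add: sum_subtractf left_diff_distrib)
    also have "\<dots> = (\<Sum>y\<in>V1. x y - 2 * (if y \<in> branch V1 E1 u i then x y else 0))"
      using d by (intro sum.cong refl) auto
    also have "\<dots> = sum x V1 - 2 * (\<Sum>y\<in>V1. if y \<in> branch V1 E1 u i then x y else 0)"
      by (simp add: sum_subtractf sum_distrib_left)
    also have "(\<Sum>y\<in>V1. if y \<in> branch V1 E1 u i then x y else 0) = sum x (branch V1 E1 u i)"
      using fin branch_sub[of V1 E1 u i] by (simp add: sum.inter_restrict[symmetric] Int_absorb1 branchD(1) subsetI)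
    finally show ?thesis .
  qed
  have X: "sum x V = sum x V1 + sum x V2" unfolding V using fin S(3) by (simp add: sum.union_disjoint)
  have "quad V (rdist (move E u j i)) x - quad V (rdist E) x
    = 2 * ((\<Sum>y\<in>V1. rdist E1 y i * x y) - (\<Sum>y\<in>V1. rdist E1 y u * x y)) * sum x V2"
    unfolding F V unfolding E quad_join[OF S] quad_join[OF S'] by (simp add: algebra_simps)
  then show "quad V (rdist (move E u j i)) x = quad V (rdist E) x + 2 * sum x (branch V E u j)
       * (sum x V - sum x (branch V E u j) - 2 * sum x (branch V E u i))"
    unfolding shift X W B by (simp add: algebra_simps)
qed

lemma radius_less_quad:
  assumes fin: "finite V" "V \<noteq> {}" and sym: "sym F" and v: "v \<in> V" "x v \<noteq> 0"
    and less: "\<mu> * (\<Sum>v\<in>V. (x v)\<^sup>2) < quad V (rdist F) x"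
  shows "\<mu> < radius V F"
proof -
  have "\<mu> * (\<Sum>v\<in>V. (x v)\<^sup>2) < radius V F * (\<Sum>v\<in>V. (x v)\<^sup>2)"
    using less radius_top_eigenvalue[OF fin sym] unfolding top_eigenvalue_def by (meson order_less_le_trans)
  then show ?thesis using sum_squares_pos[OF fin(1) v(1), of x] v(2) by simp
qed

text \<open>
  The witness \<open>c\<close> is a neighbour whose branch has the largest Perron weight. The branches of \<open>i\<close>, \<open>j\<close>
  and \<open>c\<close> are disjoint and miss \<open>u\<close>, so the total weight exceeds that of \<open>j\<close> by more than
  twice that of \<open>i\<close>.
\<close>

lemma move_increases_radius:
  assumes T: "is_tree V E" and deg: "3 \<le> card (E `` {u})"
  obtains c where "c \<in> E `` {u}"
    "\<And>i j. i \<in> E `` {u} - {c} \<Longrightarrow> j \<in> E `` {u} - {c} \<Longrightarrow> i \<noteq> j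
      \<Longrightarrow> radius V E < radius V (move E u j i)"
proof -
  note J = is_tree_sym_connected[OF T] and fin = is_tree_finite[OF T]
  have N: "finite (E `` {u})" "E `` {u} \<noteq> {}" using deg by (auto simp: card_eq_0_iff intro: card_ge_0_finite)
  have u: "u \<in> V" using N is_tree_sub[OF T] by blast
  have sub: "E `` {u} \<subseteq> V" using is_tree_sub[OF T] by blast
  have V: "finite V" "2 \<le> card V" using deg card_mono[OF _ sub] fin by auto
  obtain x where "\<forall>v\<in>V. 0 < x v" and "\<forall>u\<in>V. (\<Sum>v\<in>V. rdist E u v * x v) = radius V E * x u"
    using sym_connected_perron_vector[OF V J] by blast
  note x = bspec[OF this(1)] and ev = bspec[OF this(2)]
  define w where "w c = sum x (branch V E u c)" for c
  obtain c where c: "c \<in> E `` {u}" and cmax: "\<And>i. i \<in> E `` {u} \<Longrightarrow> w i \<le> w c"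
  proof -
    have "Max (w ` (E `` {u})) \<in> w ` (E `` {u})" using N by simp
    then obtain c where "c \<in> E `` {u}" "w c = Max (w ` (E `` {u}))" by force
    then show ?thesis using that[of c] N by simp
  qed
  have "radius V E < radius V (move E u j i)"
    if ij: "i \<in> E `` {u} - {c}" "j \<in> E `` {u} - {c}" "i \<noteq> j" for i j
  proof -
    have e: "(u, i) \<in> E" "(u, j) \<in> E" "(u, c) \<in> E" using ij c by auto
    note M = move_tree[OF T e(1,2) ij(3)]
    have disj: "branch V E u i \<inter> branch V E u j = {}" "branch V E u i \<inter> branch V E u c = {}"
      "branch V E u j \<inter> branch V E u c = {}"
      using branches_disjoint[OF T] e ij by auto
    have finb: "finite (branch V E u k)" for k using fin branch_sub finite_subset by (metis finite_Diff)
    let ?U = "branch V E u i \<union> branch V E u j \<union> branch V E u c"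
    have "w i + w j + w c + x u = sum x (insert u ?U)"
      using disj finb branch_sub[of V E u] unfolding w_def
      by (subst sum.insert, simp, blast) (simp add: sum.union_disjoint Int_Un_distrib2)
    also have "\<dots> \<le> sum x V"
      using fin u branch_sub[of V E u] x by (intro sum_mono2) (auto simp: less_imp_le)
    finally have "0 < sum x V - w j - 2 * w i" using cmax[of i] ij x[OF u] by simp
    moreover have "0 < w j"
      unfolding w_def using finb branch_self[OF T e(2)] branch_sub[of V E u j] x
      by (intro sum_pos) auto
    ultimately have "quad V (rdist E) x < quad V (rdist (move E u j i)) x"
      unfolding M(3) w_def[symmetric] by simp
    moreover have "quad V (rdist E) x = radius V E * (\<Sum>v\<in>V. (x v)\<^sup>2)"
      using ev by (intro quad_eigenvector) auto
    ultimately show ?thesis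
      using radius_less_quad[of V "move E u j i" u x "radius V E"] fin is_tree_sym[OF M(1)] u x[OF u]
      by simp
  qed
  then show ?thesis using c that by blast
qed

section \<open>Recognising paths and paths with a pendant vertex\<close>

lemma sym_connected_closed:
  assumes J: "sym_connected V E" and u: "u \<in> V" "u \<in> S" and closed: "E `` S \<subseteq> S"
  shows "V \<subseteq> S"
proof
  fix v assume "v \<in> V"
  then obtain k where "(u, v) \<in> E ^^ k" using J u unfolding sym_connected_def by blast
  then show "v \<in> S"
  proof (induction k arbitrary: v)
    case (Suc k)
    then obtain w where "(u, w) \<in> E ^^ k" "(w, v) \<in> E" by auto
    then show ?case using Suc.IH[of w] closed by blast
  qed (use u in simp)
qed

fun path_edges :: "'a list \<Rightarrow> 'a rel" where
  "path_edges (x # y # zs) = bridge x y \<union> path_edges (y # zs)"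
| "path_edges _ = {}"

lemma path_edges_append:
  "xs \<noteq> [] \<Longrightarrow> ys \<noteq> [] \<Longrightarrow>
    path_edges (xs @ ys) = path_edges xs \<union> path_edges ys \<union> bridge (last xs) (hd ys)"
proof (induction xs rule: path_edges.induct)
  case ("2_2" x)
  then show ?case by (cases ys) auto
qed auto

lemma path_edges_rev: "path_edges (rev xs) = path_edges xs"
proof (induction xs rule: path_edges.induct)
  case (1 x y zs)
  have "path_edges (rev (x # y # zs)) = path_edges (rev (y # zs)) \<union> bridge y x"
    using path_edges_append[of "rev (y # zs)" "[x]"] by simp
  then show ?case using 1 bridge_commute[of x y] by auto
qed auto

lemma path_edges_sub: "path_edges xs \<subseteq> set xs \<times> set xs"
  by (induction xs rule: path_edges.induct) (auto simp: bridge_def)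

lemma path_edges_nth: "path_edges xs = (\<Union>i\<in>{i. Suc i < length xs}. bridge (xs ! i) (xs ! Suc i))"
proof (induction xs rule: path_edges.induct)
  case (1 x y zs)
  have "{i. Suc i < length (x # y # zs)} = insert 0 (Suc ` {i. Suc i < length (y # zs)})"
    by (auto simp: image_iff gr0_conv_Suc less_Suc_eq_0_disj)
  then show ?case using 1 by simp
qed auto

text \<open>
  Used contrapositively: a vertex of a path with at most one neighbour is an end.
\<close>

lemma path_inner_degree:
  assumes "distinct xs" "v \<in> set xs" "v \<noteq> hd xs" "v \<noteq> last xs"
  shows "2 \<le> card (path_edges xs `` {v})"
proof -
  obtain as bs where xs: "xs = as @ v # bs" using split_list[OF assms(2)] by blast
  have ne: "as \<noteq> []" "bs \<noteq> []" using xs assms(3,4) by auto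
  have "last as \<in> set as" "hd bs \<in> set bs" using ne by auto
  then have neq: "last as \<noteq> hd bs" using assms(1) unfolding xs by auto
  have "path_edges xs = path_edges as \<union> path_edges (v # bs) \<union> bridge (last as) v"
    using path_edges_append[of as "v # bs"] ne xs by simp
  moreover have "path_edges (v # bs) = bridge v (hd bs) \<union> path_edges bs"
    using ne by (cases bs) auto
  ultimately have "{last as, hd bs} \<subseteq> path_edges xs `` {v}" by (auto simp: bridge_def)
  moreover have "finite (path_edges xs `` {v})"
    using path_edges_sub[of xs] by (meson List.finite_set finite_Image finite_SigmaI finite_subset)
  ultimately have "card {last as, hd bs} \<le> card (path_edges xs `` {v})" by (rule card_mono[rotated])
  then show ?thesis using neq by simp
qed

lemma tree_path:
  assumes "is_tree V E" "\<And>v. card (E `` {v}) \<le> 2"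
  obtains xs where "distinct xs" "set xs = V" "E = path_edges xs"
proof -
  have "\<exists>xs. distinct xs \<and> set xs = V \<and> E = path_edges xs"
    using assms
  proof (induction rule: is_tree.induct)
    case (single v)
    then show ?case by (intro exI[of _ "[v]"]) auto
  next
    case (join V1 E1 V2 E2 a b)
    let ?E = "E1 \<union> E2 \<union> bridge a b"
    have T: "is_tree (V1 \<union> V2) ?E" by (rule is_tree.join[OF join.hyps])
    have fin: "finite (?E `` {v})" for v using is_tree_edges_finite[OF T] by (rule finite_Image)
    have sub: "E1 \<subseteq> V1 \<times> V1" "E2 \<subseteq> V2 \<times> V2" using join.hyps is_tree_sub by auto
    \<comment> \<open>The joining vertices already use one of their two edges, so each ends its path.\<close>
    have oriented: "\<exists>xs. distinct xs \<and> set xs = W \<and> F = path_edges xs \<and> last xs = w"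
      if IH: "(\<And>v. card (F `` {v}) \<le> 2) \<Longrightarrow> \<exists>xs. distinct xs \<and> set xs = W \<and> F = path_edges xs"
        and F: "F \<subseteq> ?E" "F \<subseteq> W \<times> W" and w: "w \<in> W" "w' \<notin> W" "(w, w') \<in> ?E" for W F w w'
    proof -
      have "card (F `` {v}) \<le> 2" for v
        using card_mono[OF fin, of "F `` {v}" v] F(1) join.prems[of v] by fastforce
      then obtain xs where xs: "distinct xs" "set xs = W" "F = path_edges xs" using IH by blast
      have "insert w' (F `` {w}) \<subseteq> ?E `` {w}" "w' \<notin> F `` {w}" using F w by auto
      then have "Suc (card (F `` {w})) \<le> 2"
        using card_mono[OF fin, of "insert w' (F `` {w})" w] join.prems[of w]
          finite_subset[OF _ fin, of "F `` {w}" w] by simp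
      then have "w = hd xs \<or> w = last xs"
        using path_inner_degree[OF xs(1), of w] xs w(1) by fastforce
      then show ?thesis
      proof
        assume "w = hd xs"
        then have "last (rev xs) = w" using w(1) xs(2) by (cases xs) auto
        then show ?thesis using xs by (intro exI[of _ "rev xs"]) (simp add: path_edges_rev)
      qed (use xs in blast)
    qed
    have ab: "b \<notin> V1" "a \<notin> V2" "(a, b) \<in> ?E" "(b, a) \<in> ?E" using join.hyps by (auto simp: bridge_def)
    obtain xs where xs: "distinct xs" "set xs = V1" "E1 = path_edges xs" "last xs = a"
      using oriented[of E1 V1 a b, OF join.IH(1) _ sub(1) join.hyps(4) ab(1,3)] by auto
    obtain ys where ys: "distinct ys" "set ys = V2" "E2 = path_edges ys" "last ys = b"
      using oriented[of E2 V2 b a, OF join.IH(2) _ sub(2) join.hyps(5) ab(2,4)] by auto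
    have ne: "xs \<noteq> []" "ys \<noteq> []" using xs ys join.hyps by auto
    have "path_edges (xs @ rev ys) = ?E"
      using path_edges_append[of xs "rev ys"] ne xs ys by (simp add: path_edges_rev hd_rev)
    then show ?case
      using xs ys join.hyps(3) by (intro exI[of _ "xs @ rev ys"]) auto
  qed
  then show ?thesis using that by blast
qed

lemma remove_leaf:
  assumes T: "is_tree V E" and leaf: "E `` {z} = {w}"
  shows "is_tree (V - {z}) (E - bridge w z)"
    and "(w, z) \<in> E" and "w \<in> V" and "z \<in> V" and "w \<noteq> z"
proof -
  show wz: "(w, z) \<in> E" using leaf is_tree_sym[OF T] by (auto simp: sym_def)
  show V: "w \<in> V" "z \<in> V" using wz is_tree_sub[OF T] by auto
  show "w \<noteq> z" using wz is_tree_irrefl[OF T] by blast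
  obtain V1 E1 V2 E2 where S: "is_tree V1 E1" "is_tree V2 E2" "V1 \<inter> V2 = {}" "w \<in> V1" "z \<in> V2"
    and V: "V = V1 \<union> V2" and E: "E = E1 \<union> E2 \<union> bridge w z" and B: "branch V E w z = V2"
    using tree_split_branch[OF T wz] by blast
  have V2: "V2 = {z}" using B branch_leaf[OF T leaf] by simp
  have "E2 = {}" using is_tree_sub[OF S(2)] is_tree_irrefl[OF S(2), of z] unfolding V2 by auto
  then have "E - bridge w z = E1"
    using is_tree_sub[OF S(1)] S(3,5) unfolding E bridge_def by auto
  moreover have "V - {z} = V1" using V V2 S(3) by auto
  ultimately show "is_tree (V - {z}) (E - bridge w z)" using S(1) by simp
qed

text \<open>
  Without the leaf \<open>a\<close> no vertex has degree above two, so what remains is a path; the other leaf \<open>b\<close> is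
  an end of it and is taken as the first vertex.
\<close>

lemma pendant_path:
  assumes T: "is_tree V E" and a: "E `` {a} = {u}" and u: "card (E `` {u}) \<le> 3"
    and others: "\<And>v. v \<noteq> u \<Longrightarrow> card (E `` {v}) \<le> 2" and b: "E `` {b} = {w}" "b \<noteq> a"
  obtains ys where "distinct (b # ys)" "a \<notin> set (b # ys)" "V = insert a (set (b # ys))"
    "E = path_edges (b # ys) \<union> bridge u a"
proof -
  let ?E = "E - bridge u a"
  note R = remove_leaf[OF T a]
  have fin: "finite (E `` {v})" for v using is_tree_edges_finite[OF T] by (rule finite_Image)
  have deg: "card (?E `` {v}) \<le> 2" for v
  proof (cases "v = u")
    case True
    have "?E `` {u} = E `` {u} - {a}" using R(5) by (auto simp: bridge_def)
    then show ?thesis using u R(2) fin[of u] True by (simp add: card_Diff_singleton)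
  next
    case False
    have "card (?E `` {v}) \<le> card (E `` {v})" by (rule card_mono[OF fin]) auto
    then show ?thesis using others[OF False] by simp
  qed
  obtain xs where xs: "distinct xs" "set xs = V - {a}" "?E = path_edges xs"
    using tree_path[OF R(1) deg] by blast
  have bV: "b \<in> set xs" using remove_leaf(4)[OF T b(1)] b(2) xs(2) by blast
  have "card (?E `` {b}) \<le> card {w}" using b(1) by (intro card_mono) auto
  then have "b = hd xs \<or> b = last xs" using path_inner_degree[OF xs(1) bV] xs(3) by fastforce
  then obtain zs where zs: "distinct zs" "set zs = V - {a}" "?E = path_edges zs" "b = hd zs"
  proof
    assume "b = last xs"
    then show ?thesis using that[of "rev xs"] xs bV by (simp add: path_edges_rev hd_rev)
  qed (use that xs in blast)
  have "b \<in> set zs" using bV unfolding xs(2) zs(2) .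
  then have Cons: "zs = b # tl zs" using zs(4) by (cases zs) simp_all
  have "(a, u) \<in> E" using a by blast
  then have "bridge u a \<subseteq> E" using R(2) by (simp add: bridge_def)
  then have "E = ?E \<union> bridge u a" by blast
  then have "E = path_edges (b # tl zs) \<union> bridge u a" using zs(3) Cons by simp
  moreover have "V = insert a (set (b # tl zs))" "a \<notin> set (b # tl zs)" "distinct (b # tl zs)"
    unfolding Cons[symmetric] using zs(1,2) R(4) by auto
  ultimately show ?thesis using that by blast
qed

text \<open>
  The degree patterns of \<open>A\<close> and \<open>B\<close>, which characterise these trees up to isomorphism and are easy to
  follow through a move.
\<close>

definition A_like :: "'a rel \<Rightarrow> bool" where
  "A_like E \<longleftrightarrow> (\<exists>u a b. card (E `` {u}) = 3 \<and> E `` {a} = {u} \<and> E `` {b} = {u} \<and> a \<noteq> b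
     \<and> (\<forall>v. v \<noteq> u \<longrightarrow> card (E `` {v}) \<le> 2))"

definition B_like :: "'a rel \<Rightarrow> bool" where
  "B_like E \<longleftrightarrow> (\<exists>u a y z. card (E `` {u}) = 3 \<and> E `` {a} = {u} \<and> E `` {y} = {u, z} \<and> E `` {z} = {y}
     \<and> u \<noteq> z \<and> (\<forall>v. v \<noteq> u \<longrightarrow> card (E `` {v}) \<le> 2))"

lemma A_like_path:
  assumes T: "is_tree V E" and A: "A_like E"
  obtains a b u ys where "distinct (b # u # ys)" "a \<notin> set (b # u # ys)"
    "V = insert a (set (b # u # ys))" "E = path_edges (b # u # ys) \<union> bridge u a"
proof -
  obtain u a b where *: "card (E `` {u}) = 3" "E `` {a} = {u}" "E `` {b} = {u}" "a \<noteq> b"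
    "\<And>v. v \<noteq> u \<Longrightarrow> card (E `` {v}) \<le> 2"
    using A unfolding A_like_def by auto
  obtain ys where ys: "distinct (b # ys)" "a \<notin> set (b # ys)" "V = insert a (set (b # ys))"
    "E = path_edges (b # ys) \<union> bridge u a"
    using pendant_path[OF T *(2) _ *(5,3)] *(1,4) by auto
  have u: "u \<in> V" "u \<noteq> a" "u \<noteq> b" using remove_leaf(3,5)[OF T *(2)] remove_leaf(5)[OF T *(3)] by auto
  then obtain c zs where c: "ys = c # zs" using ys(3) by (cases ys) auto
  have "c \<in> E `` {b}" unfolding ys(4) c by (simp add: bridge_def)
  then have "c = u" using *(3) by simp
  then show ?thesis using that ys c by simp
qed

lemma B_like_path:
  assumes T: "is_tree V E" and B: "B_like E"
  obtains a z y u ys where "distinct (z # y # u # ys)" "a \<notin> set (z # y # u # ys)"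
    "V = insert a (set (z # y # u # ys))" "E = path_edges (z # y # u # ys) \<union> bridge u a"
proof -
  obtain u a y z where *: "card (E `` {u}) = 3" "E `` {a} = {u}" "E `` {y} = {u, z}" "E `` {z} = {y}"
    "u \<noteq> z" "\<And>v. v \<noteq> u \<Longrightarrow> card (E `` {v}) \<le> 2"
    using B unfolding B_like_def by auto
  have yu: "y \<noteq> u" using *(3) is_tree_irrefl[OF T, of u] by auto
  then have za: "z \<noteq> a" using *(2,4) by auto
  have ya: "y \<noteq> a" using *(2,3,5) by auto
  obtain ys where ys: "distinct (z # ys)" "a \<notin> set (z # ys)" "V = insert a (set (z # ys))"
    "E = path_edges (z # ys) \<union> bridge u a"
    using pendant_path[OF T *(2) _ *(6,4) za] *(1) by auto
  have u: "u \<in> V" "u \<noteq> a" using remove_leaf(3,5)[OF T *(2)] by auto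
  then obtain c zs where c: "ys = c # zs" using ys(3) *(5) by (cases ys) auto
  have "c \<in> E `` {z}" unfolding ys(4) c by (simp add: bridge_def)
  then have cy: "c = y" using *(4) by simp
  obtain d ws where d: "zs = d # ws" using u ys(3) c cy *(5) yu by (cases zs) auto
  have "d \<in> E `` {y}" "d \<noteq> z" using ys(1) unfolding ys(4) c d cy by (auto simp: bridge_def)
  then have "d = u" using *(3) by simp
  then show ?thesis using that ys c cy d by simp
qed

section \<open>Trees that do not maximise the radius\<close>

lemma move_Image:
  assumes "u \<noteq> i" "u \<noteq> j" "i \<noteq> j"
  shows "move E u j i `` {w} = (if w = u then E `` {u} - {j} else if w = i then insert j (E `` {i})
     else if w = j then insert i (E `` {j} - {u}) else E `` {w})"
  using assms by (auto simp: move_def bridge_def)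

lemma tree_edge_neq: "is_tree V E \<Longrightarrow> (u, v) \<in> E \<Longrightarrow> u \<noteq> v"
  using is_tree_irrefl by metis

lemma tree_edge_sym: "is_tree V E \<Longrightarrow> (u, v) \<in> E \<Longrightarrow> (v, u) \<in> E"
  using is_tree_sym by (metis symD)

lemma tree_finite_nbrs: "is_tree V E \<Longrightarrow> finite (E `` S)"
  using is_tree_edges_finite by (metis finite_Image)

lemma move_degrees:
  assumes T: "is_tree V E" and e: "(u, i) \<in> E" "(u, j) \<in> E" and ne: "i \<noteq> j"
  shows "card (move E u j i `` {u}) = card (E `` {u}) - 1"
    and "card (move E u j i `` {i}) = Suc (card (E `` {i}))"
    and "w \<noteq> u \<Longrightarrow> card (E `` {w}) \<le> card (move E u j i `` {w})"
proof -
  note d = tree_edge_neq[OF T e(1)] tree_edge_neq[OF T e(2)] ne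
  note fin = tree_finite_nbrs[OF T]
  have nij: "j \<notin> E `` {i}" "i \<notin> E `` {j}" using move_tree(2)[OF T e ne] tree_edge_sym[OF T] by auto
  show "card (move E u j i `` {u}) = card (E `` {u}) - 1"
    using e(2) by (simp add: move_Image[OF d])
  show i: "card (move E u j i `` {i}) = Suc (card (E `` {i}))"
    using nij fin d by (auto simp: move_Image[OF d])
  have "card (move E u j i `` {j}) = card (E `` {j})"
  proof -
    have "u \<in> E `` {j}" using tree_edge_sym[OF T e(2)] by blast
    then have "Suc (card (E `` {j} - {u})) = card (E `` {j})" by (rule card_Suc_Diff1[OF fin])
    then show ?thesis using nij fin d by (auto simp: move_Image[OF d])
  qed
  then show "w \<noteq> u \<Longrightarrow> card (E `` {w}) \<le> card (move E u j i `` {w})"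
    using i d by (cases "w = i"; cases "w = j") (auto simp: move_Image[OF d])
qed

lemma two_elements:
  assumes "2 \<le> card S"
  obtains i j where "i \<in> S" "j \<in> S" "i \<noteq> j"
  using assms by (metis card_le_Suc0_iff_eq card.infinite not_less_eq_eq numeral_2_eq_2 zero_le)

lemma better_tree:
  assumes T: "is_tree V E" and deg: "3 \<le> card (E `` {u})"
  shows "\<exists>F. is_tree V F \<and> radius V E < radius V F"
proof -
  obtain c where c: "c \<in> E `` {u}" and inc: "\<And>i j. i \<in> E `` {u} - {c} \<Longrightarrow> j \<in> E `` {u} - {c} \<Longrightarrow> i \<noteq> j
      \<Longrightarrow> radius V E < radius V (move E u j i)"
    using move_increases_radius[OF T deg] by blast
  have "2 \<le> card (E `` {u} - {c})" using deg c by simp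
  then obtain i j where ij: "i \<in> E `` {u} - {c}" "j \<in> E `` {u} - {c}" "i \<noteq> j"
    by (rule two_elements)
  then show ?thesis using inc[OF ij] move_tree(1)[OF T _ _ ij(3), of u] by auto
qed

lemma not_A_like_4: "4 \<le> card (F `` {v}) \<Longrightarrow> \<not> A_like F"
proof
  assume "4 \<le> card (F `` {v})" "A_like F"
  then obtain u where "card (F `` {u}) = 3" "v \<noteq> u \<longrightarrow> card (F `` {v}) \<le> 2"
    unfolding A_like_def by blast
  with \<open>4 \<le> card (F `` {v})\<close> show False by (cases "v = u") auto
qed

lemma not_A_like_two: "3 \<le> card (F `` {v}) \<Longrightarrow> 3 \<le> card (F `` {w}) \<Longrightarrow> v \<noteq> w \<Longrightarrow> \<not> A_like F"
proof
  assume *: "3 \<le> card (F `` {v})" "3 \<le> card (F `` {w})" "v \<noteq> w" "A_like F"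
  then obtain u where "v \<noteq> u \<longrightarrow> card (F `` {v}) \<le> 2" "w \<noteq> u \<longrightarrow> card (F `` {w}) \<le> 2"
    unfolding A_like_def by blast
  with * show False by (cases "v = u"; cases "w = u") auto
qed

lemma not_A_like_nonleaves:
  assumes T: "is_tree V F" and deg: "3 \<le> card (F `` {u})" and nb: "p \<in> F `` {u}" "q \<in> F `` {u}" "p \<noteq> q"
    and nonleaf: "F `` {p} \<noteq> {u}" "F `` {q} \<noteq> {u}"
  shows "\<not> A_like F"
proof
  assume "A_like F"
  then obtain w a b where A: "card (F `` {w}) = 3" "F `` {a} = {w}" "F `` {b} = {w}" "a \<noteq> b"
     "\<forall>v. v \<noteq> w \<longrightarrow> card (F `` {v}) \<le> 2"
    unfolding A_like_def by blast
  have w: "w = u" using A(5) deg by (metis not_less_eq_eq numeral_2_eq_2 numeral_3_eq_3)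
  have "{a, b, p, q} \<subseteq> F `` {u}" using A(2,3) nb tree_edge_sym[OF T] w by blast
  then have "card {a, b, p, q} \<le> 3" using A(1) w tree_finite_nbrs[OF T] by (metis card_mono)
  moreover have "a \<noteq> p" "a \<noteq> q" "b \<noteq> p" "b \<noteq> q" using A(2,3) nonleaf w by auto
  ultimately show False using A(4) nb(3) by simp
qed

lemma three_neighbours:
  assumes "card S = 3" "a \<in> S" "b \<in> S" "a \<noteq> b"
  obtains q where "S = {a, b, q}" "q \<noteq> a" "q \<noteq> b"
proof -
  have fin: "finite S" using assms(1) by (metis card.infinite zero_neq_numeral)
  then have "card (S - {a} - {b}) = 1" using assms by simp
  then obtain q where "S - {a} - {b} = {q}" by (metis card_1_singletonE)
  then have "S = {a, b, q}" "q \<noteq> a" "q \<noteq> b" using assms by auto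
  then show ?thesis using that by blast
qed

text \<open>
  A move leaves a vertex of degree at least three behind unless \<open>u\<close> is the only one, has degree
  exactly three, and both branches available for moving are leaves; that is the shape of \<open>A\<close>.
\<close>

lemma better_branching_tree:
  assumes T: "is_tree V E" and deg: "3 \<le> card (E `` {u})" and A: "\<not> A_like E"
  shows "\<exists>F v. is_tree V F \<and> radius V E < radius V F \<and> 3 \<le> card (F `` {v})"
proof -
  obtain c where c: "c \<in> E `` {u}" and inc: "\<And>i j. i \<in> E `` {u} - {c} \<Longrightarrow> j \<in> E `` {u} - {c} \<Longrightarrow> i \<noteq> j
      \<Longrightarrow> radius V E < radius V (move E u j i)"
    using move_increases_radius[OF T deg] by blast
  have "2 \<le> card (E `` {u} - {c})" using deg c by simp
  then obtain i j where ij: "i \<in> E `` {u} - {c}" "j \<in> E `` {u} - {c}" "i \<noteq> j"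
    by (rule two_elements)
  have e: "(u, i) \<in> E" "(u, j) \<in> E" using ij by auto
  note fin = tree_finite_nbrs[OF T]
  have leaf: "E `` {i} = {u}" if "(u, i) \<in> E" "\<not> 2 \<le> card (E `` {i})" for i
  proof -
    have "{u} \<subseteq> E `` {i}" using tree_edge_sym[OF T that(1)] by blast
    moreover have "card (E `` {i}) \<le> card {u}" using that(2) by simp
    ultimately show ?thesis using card_seteq[OF fin] by metis
  qed
  note D = move_degrees[OF T e ij(3)] and D' = move_degrees[OF T e(2,1) ij(3)[symmetric]]
  note M = move_tree(1)[OF T e ij(3)] inc[OF ij]
    and M' = move_tree(1)[OF T e(2,1) ij(3)[symmetric]] inc[OF ij(2,1) ij(3)[symmetric]]
  have three: "card (E `` {u}) = 3" if "\<not> 4 \<le> card (E `` {u})" using deg that by linarith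
  have low: "\<forall>w. w \<noteq> u \<longrightarrow> card (E `` {w}) \<le> 2" if "\<nexists>w. w \<noteq> u \<and> 3 \<le> card (E `` {w})"
  proof (intro allI impI)
    fix w assume "w \<noteq> u"
    then have "\<not> 3 \<le> card (E `` {w})" using that by blast
    then show "card (E `` {w}) \<le> 2" by linarith
  qed
  consider "4 \<le> card (E `` {u})" | w where "w \<noteq> u" "3 \<le> card (E `` {w})"
    | "2 \<le> card (E `` {i})" | "2 \<le> card (E `` {j})"
    | "card (E `` {u}) = 3" "\<forall>w. w \<noteq> u \<longrightarrow> card (E `` {w}) \<le> 2"
      "\<not> 2 \<le> card (E `` {i})" "\<not> 2 \<le> card (E `` {j})"
    using three low by blast
  then show ?thesis
  proof cases
    case 1
    then show ?thesis using M D(1) by (intro exI[of _ "move E u j i"] exI[of _ u]) auto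
  next
    case 2
    then show ?thesis using M D(3)[of w] by (intro exI[of _ "move E u j i"] exI[of _ w]) auto
  next
    case 3
    then show ?thesis using M D(2) by (intro exI[of _ "move E u j i"] exI[of _ i]) auto
  next
    case 4
    then show ?thesis using M' D'(2) by (intro exI[of _ "move E u i j"] exI[of _ j]) auto
  next
    case 5
    then have "A_like E" unfolding A_like_def
      using leaf[OF e(1) 5(3)] leaf[OF e(2) 5(4)] ij(3)
      by (intro exI[of _ u] exI[of _ i] exI[of _ j]) simp
    then show ?thesis using A by blast
  qed
qed

text \<open>
  For the third place the better tree has to avoid both \<open>A\<close> and the path, which is the tree without a
  vertex of degree at least three.
\<close>

definition improves_off_A :: "'a set \<Rightarrow> 'a rel \<Rightarrow> 'a rel \<Rightarrow> bool" where
  "improves_off_A V E F \<longleftrightarrow> is_tree V F \<and> radius V E < radius V F \<and> (\<exists>v. 3 \<le> card (F `` {v})) \<and> \<not> A_like F"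

lemma small_closed:
  assumes T: "is_tree V E" and six: "6 \<le> card V" and u: "u \<in> V" "u \<in> S"
    and S: "card S \<le> 5" "finite S" "E `` S \<subseteq> S"
  shows False
  using sym_connected_closed[OF is_tree_sym_connected[OF T] u S(3)] card_mono[OF S(2), of V] S(1) six by simp

text \<open>
  If one of the branches other than the heaviest is not a leaf, another one is moved onto its root,
  which then has degree at least three. The result could be \<open>A\<close> only if \<open>u\<close> was the only vertex of
  degree at least three and had exactly three neighbours, and then only if the tree was \<open>B\<close>. If all of them are leaves and there are at least
  three, one leaf is moved onto another; the result would be \<open>A\<close> only with five vertices in total.
\<close>

lemma better_tree_at_vertex:
  assumes T: "is_tree V E" and six: "6 \<le> card V" and deg: "3 \<le> card (E `` {u})"
    and A: "\<not> A_like E" and B: "\<not> B_like E"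
  shows "(\<exists>F. improves_off_A V E F) \<or>
    (card (E `` {u}) = 3 \<and> (\<exists>a b. a \<noteq> b \<and> E `` {a} = {u} \<and> E `` {b} = {u}))"
proof -
  obtain c where c: "c \<in> E `` {u}" and inc: "\<And>i j. i \<in> E `` {u} - {c} \<Longrightarrow> j \<in> E `` {u} - {c} \<Longrightarrow> i \<noteq> j
      \<Longrightarrow> radius V E < radius V (move E u j i)"
    using move_increases_radius[OF T deg] by blast
  note fin = tree_finite_nbrs[OF T]
  have two: "2 \<le> card (E `` {u} - {c})" using deg c by simp
  have uV: "u \<in> V" using c is_tree_sub[OF T] by blast
  show ?thesis
  proof (cases "\<exists>i\<in>E `` {u} - {c}. E `` {i} \<noteq> {u}")
    case True
    then obtain i where i: "i \<in> E `` {u} - {c}" "E `` {i} \<noteq> {u}" by blast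
    obtain j where j: "j \<in> E `` {u} - {c}" "j \<noteq> i" using two two_elements by metis
    have e: "(u, i) \<in> E" "(u, j) \<in> E" "i \<noteq> j" using i j by auto
    note d = tree_edge_neq[OF T e(1)] tree_edge_neq[OF T e(2)] e(3)
    let ?F = "move E u j i"
    note M = move_tree(1)[OF T e] and inc' = inc[OF i(1) j(1) e(3)] and D = move_degrees[OF T e]
    have ui: "u \<in> E `` {i}" using tree_edge_sym[OF T e(1)] by blast
    then obtain z where z: "z \<in> E `` {i}" "z \<noteq> u" using i(2) by blast
    have "{u, z} \<subseteq> E `` {i}" using ui z by blast
    then have i2: "2 \<le> card (E `` {i})" using card_mono[OF fin, of "{u, z}" "{i}"] z(2) by simp
    then have Fi: "3 \<le> card (?F `` {i})" using D(2) by simp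
    have "\<not> A_like ?F" if "A_like ?F"
    proof -
      have three: "card (E `` {u}) = 3" if "\<not> 4 \<le> card (E `` {u})" using deg that by linarith
      consider "4 \<le> card (E `` {u})" | w where "w \<noteq> u" "3 \<le> card (E `` {w})"
        | "card (E `` {u}) = 3" "\<forall>w. w \<noteq> u \<longrightarrow> \<not> 3 \<le> card (E `` {w})"
        using three by blast
      then show ?thesis
      proof cases
        case 1
        then show ?thesis using not_A_like_two[of ?F u i] D(1) Fi d by auto
      next
        case 2
        show ?thesis
        proof (cases "w = i")
          case True
          then show ?thesis using not_A_like_4[of ?F i] 2 D(2) by simp
        next
          case False
          then show ?thesis using not_A_like_two[of ?F w i] 2 D(3)[of w] Fi by simp
        qed
      next
        case 3
        have low: "card (E `` {w}) \<le> 2" if "w \<noteq> u" for w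
        proof -
          have "\<not> 3 \<le> card (E `` {w})" using 3(2) that by blast
          then show ?thesis by linarith
        qed
        have "card (E `` {i}) \<le> card {u, z}" using low[of i] z(2) d(1) by simp
        then have iz: "E `` {i} = {u, z}" using card_seteq[OF fin \<open>{u, z} \<subseteq> E `` {i}\<close>] by simp
        have zj: "z \<noteq> j" "z \<noteq> i" using move_tree(2)[OF T e] z(1) tree_edge_neq[OF T] by auto
        have Fi': "?F `` {i} = {j, u, z}" using iz d by (simp add: move_Image[OF d(1,2,3)])
        have "c \<in> ?F `` {u}" "c \<noteq> i"
          using c i(1) j(1) unfolding move_Image[OF d] by (simp_all, blast+)
        then have Fu: "?F `` {u} \<noteq> {i}" by blast
        have nleaf: "E `` {j} \<noteq> {u} \<or> E `` {z} \<noteq> {i}"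
        proof (rule ccontr)
          assume "\<not> ?thesis"
          then have "E `` {j} = {u}" "E `` {z} = {i}" by blast+
          then have "B_like E" unfolding B_like_def
            using 3(1) low iz not_sym[OF z(2)] by metis
          then show False using B by blast
        qed
        have "?F `` {z} = E `` {z}" using z(2) zj by (simp add: move_Image[OF d])
        moreover have "?F `` {j} \<noteq> {i}" if nj: "E `` {j} \<noteq> {u}"
        proof -
          have "u \<in> E `` {j}" using tree_edge_sym[OF T e(2)] by simp
          then obtain y where y: "(j, y) \<in> E" "y \<noteq> u" using nj by blast
          then have "y \<noteq> i" using move_tree(2)[OF T e] tree_edge_sym[OF T y(1)] by auto
          moreover have "y \<in> ?F `` {j}" using y d by (simp add: move_Image[OF d])
          ultimately show ?thesis by blast
        qed
        ultimately have "?F `` {j} \<noteq> {i} \<or> ?F `` {z} \<noteq> {i}" using nleaf by metis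
        moreover have "j \<in> ?F `` {i}" "u \<in> ?F `` {i}" "z \<in> ?F `` {i}" using Fi' by simp_all
        ultimately show ?thesis
          using not_A_like_nonleaves[OF M Fi _ _ _ Fu, of j] not_A_like_nonleaves[OF M Fi _ _ _ Fu, of z]
            d(2) z(2) by metis
      qed
    qed
    then have "improves_off_A V E ?F" unfolding improves_off_A_def using M inc' Fi by blast
    then show ?thesis by blast
  next
    case False
    then have leaf: "E `` {i} = {u}" if "i \<in> E `` {u} - {c}" for i using that by blast
    obtain i j where ij: "i \<in> E `` {u} - {c}" "j \<in> E `` {u} - {c}" "i \<noteq> j"
      using two by (rule two_elements)
    have e: "(u, i) \<in> E" "(u, j) \<in> E" "i \<noteq> j" using ij by auto
    note d = tree_edge_neq[OF T e(1)] tree_edge_neq[OF T e(2)] e(3)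
    let ?F = "move E u j i"
    note M = move_tree(1)[OF T e] and inc' = inc[OF ij] and D = move_degrees[OF T e]
    consider "card (E `` {u}) = 3" | "card (E `` {u}) = 4" | "5 \<le> card (E `` {u})"
      using deg by linarith
    then show ?thesis
    proof cases
      case 1
      then show ?thesis using leaf[OF ij(1)] leaf[OF ij(2)] ij(3) by blast
    next
      case 2
      have Fu: "3 \<le> card (?F `` {u})" using D(1) 2 by simp
      have "E `` {c} \<noteq> {u}"
      proof
        assume "E `` {c} = {u}"
        then have "E `` {k} = {u}" if "k \<in> E `` {u}" for k
          using leaf[of k] that by (cases "k = c") simp_all
        then have "E `` (insert u (E `` {u})) \<subseteq> insert u (E `` {u})" by blast
        moreover have "card (insert u (E `` {u})) \<le> 5" using 2 card_insert_le_m1[of 5 "E `` {u}" u] by simp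
        ultimately show False
          using small_closed[OF T six uV, of "insert u (E `` {u})"] fin by blast
      qed
      moreover have cu: "c \<noteq> u" using c tree_edge_neq[OF T] by blast
      moreover have "c \<noteq> i" "c \<noteq> j" using ij by blast+
      ultimately have "?F `` {c} \<noteq> {u}" by (simp add: move_Image[OF d])
      moreover have "j \<in> ?F `` {i}" using d by (simp add: move_Image[OF d])
      then have "?F `` {i} \<noteq> {u}" using d(2) by (metis singletonD)
      moreover have "i \<in> ?F `` {u}" "c \<in> ?F `` {u}"
        using ij c \<open>c \<noteq> j\<close> by (simp_all add: move_Image[OF d])
      ultimately have "\<not> A_like ?F" using not_A_like_nonleaves[OF M Fu, of i c] ij(1) by blast
      then have "improves_off_A V E ?F" unfolding improves_off_A_def using M inc' Fu by blast
      then show ?thesis by blast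
    next
      case 3
      then have "4 \<le> card (?F `` {u})" using D(1) by simp
      then have "improves_off_A V E ?F"
        unfolding improves_off_A_def using M inc' not_A_like_4[of ?F u] by (auto intro!: exI[of _ u])
      then show ?thesis by blast
    qed
  qed
qed

section \<open>Trees with two forks\<close>

text \<open>
  A leaf \<open>a\<close> at \<open>u\<close> is one step further than \<open>u\<close> from every vertex but itself, so the eigenvalue
  equations give \<open>\<mu> (x\<^sub>a - x\<^sub>u) = S - 2 x\<^sub>a\<close>. Comparing two leaves yields \<open>x\<^sub>a = x\<^sub>b\<close>, and then
  \<open>x\<^sub>u < x\<^sub>a\<close>. The second claim follows since \<open>\<mu> x\<^sub>u \<ge> S - x\<^sub>u\<close>, all distances from \<open>u\<close> to other
  vertices being at least one.
\<close>

lemma fork_weights: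
  assumes T: "is_tree V E" and fork: "E `` {a} = {u}" "E `` {b} = {u}" "a \<noteq> b"
    and pos: "0 < \<mu>" "\<And>v. v \<in> V \<Longrightarrow> 0 < x v"
    and ev: "\<And>w. w \<in> V \<Longrightarrow> (\<Sum>y\<in>V. rdist E w y * x y) = \<mu> * x w"
  shows "x a = x b" and "x a < 2 * x u"
proof -
  note J = is_tree_sym_connected[OF T]
  have fin: "finite V" using is_tree_finite[OF T] by blast
  have leaf_eq: "\<mu> * x a - \<mu> * x u = sum x V - 2 * x a" if a: "E `` {a} = {u}" for a
  proof -
    note R = remove_leaf[OF T a]
    have d: "rdist E a y = rdist E u y + 1 - 2 * of_bool (y = a)" if "y \<in> V" for y
      using edge_gdist[OF T R(2), of y] branch_leaf[OF T a] that by (cases "y = a") auto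
    have "\<mu> * x a = (\<Sum>y\<in>V. rdist E a y * x y)" using ev R(4) by simp
    also have "\<dots> = (\<Sum>y\<in>V. rdist E u y * x y + x y - 2 * (if y = a then x y else 0))"
    proof (intro sum.cong refl)
      fix y assume "y \<in> V"
      then show "rdist E a y * x y = rdist E u y * x y + x y - 2 * (if y = a then x y else 0)"
        unfolding d[OF \<open>y \<in> V\<close>] by (simp add: algebra_simps)
    qed
    also have "\<dots> = (\<Sum>y\<in>V. rdist E u y * x y) + sum x V - 2 * (\<Sum>y\<in>V. if y = a then x y else 0)"
      by (simp add: sum.distrib sum_subtractf sum_distrib_left)
    also have "\<dots> = \<mu> * x u + sum x V - 2 * x a" using ev R(3,4) fin by simp
    finally show ?thesis by simp
  qed
  note a = remove_leaf[OF T fork(1)] and b = remove_leaf[OF T fork(2)]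
  have "(\<mu> + 2) * (x a - x b) = 0"
    using leaf_eq[OF fork(1)] leaf_eq[OF fork(2)] by (simp add: algebra_simps)
  then show ab: "x a = x b" using pos(1) by simp
  have "x u + x a + x b = sum x {u, a, b}" using a(5) b(5) fork(3) by simp
  also have "\<dots> \<le> sum x V" using a b fin pos(2) by (intro sum_mono2) (auto simp: less_imp_le)
  finally have "2 * x a < sum x V" using ab pos(2)[OF a(3)] by simp
  then have "\<mu> * x u < \<mu> * x a" using leaf_eq[OF fork(1)] by simp
  then have ua: "x u < x a" using pos(1) by simp
  have "sum x V - x u \<le> \<mu> * x u"
  proof -
    have "sum x V - x u = sum x (V - {u})" using fin a(3) by (simp add: sum_diff1)
    also have "\<dots> \<le> (\<Sum>y\<in>V - {u}. rdist E u y * x y)"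
    proof (intro sum_mono)
      fix y assume y: "y \<in> V - {u}"
      then have "0 < gdist E u y" using gdist_pos[OF J a(3), of y] by auto
      then have "1 \<le> rdist E u y" by linarith
      then have "1 * x y \<le> rdist E u y * x y"
        using pos(2)[of y] y by (intro mult_right_mono) auto
      then show "x y \<le> rdist E u y * x y" by simp
    qed
    also have "\<dots> = (\<Sum>y\<in>V. rdist E u y * x y)"
      using fin by (intro sum.mono_neutral_left) auto
    finally show ?thesis using ev[OF a(3)] by simp
  qed
  then have "0 < 2 * (\<mu> * x u) - \<mu> * x a" using leaf_eq[OF fork(1)] ua pos(2)[OF a(4)] by linarith
  then have "0 < \<mu> * (2 * x u - x a)" by (simp add: algebra_simps)
  then show "x a < 2 * x u" using pos(1) by (simp add: zero_less_mult_iff)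
qed

text \<open>
  With leaves \<open>a\<close>, \<open>b\<close> and a third neighbour \<open>q\<close> at \<open>u\<close>, and leaves \<open>c\<close>, \<open>d\<close> at \<open>v\<close>, the result has a
  leaf \<open>u\<close> and a path \<open>b\<close>, \<open>a\<close> of length two attached to \<open>q\<close>, and \<open>d\<close> attached to \<open>c\<close>. If \<open>u\<close> and \<open>v\<close> are the
  only vertices of degree three, this is \<open>B\<close>.
\<close>

definition unfork :: "'a rel \<Rightarrow> 'a \<Rightarrow> 'a \<Rightarrow> 'a \<Rightarrow> 'a \<Rightarrow> 'a \<Rightarrow> 'a \<Rightarrow> 'a \<Rightarrow> 'a rel" where
  "unfork E u a b q v c d = move (move (move (move E u b q) u a q) q a b) v d c"

lemma unfork:
  assumes T: "is_tree V E" and u: "E `` {u} = {a, b, q}" "a \<noteq> b" "q \<noteq> a" "q \<noteq> b"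
    and ab: "E `` {a} = {u}" "E `` {b} = {u}"
    and cd: "E `` {c} = {v}" "E `` {d} = {v}" "c \<noteq> d" and uv: "u \<noteq> v" and v: "E `` {v} = {c, d, r}" and r: "r \<noteq> c" "r \<noteq> d"
  defines "F \<equiv> unfork E u a b q v c d"
  shows "is_tree V F"
    and "x a = x b \<Longrightarrow> x c = x d \<Longrightarrow> quad V (rdist F) x
      = quad V (rdist E) x + 2 * ((x c - x a) * sum x V + 4 * x a * x u + (x a)\<^sup>2 - 3 * (x c)\<^sup>2)"
    and "F `` {b} = {a, q}" "F `` {c} = {v, d}"
    and "F `` {q} = (if q = v then {u, b, c} else insert b (E `` {q}))"
    and "F `` {v} = (if q = v then {u, b, c} else {c, r})"
    and "w \<notin> {u, a, b, q, v, c, d} \<Longrightarrow> F `` {w} = E `` {w}"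
proof -
  have fin: "finite V" using is_tree_finite[OF T] by blast
  have e: "(u, a) \<in> E" "(u, b) \<in> E" "(u, q) \<in> E" "(v, c) \<in> E" "(v, d) \<in> E"
    using u(1) v by blast+
  note e' = e[THEN tree_edge_sym[OF T]]
  have VV: "u \<in> V" "a \<in> V" "b \<in> V" "q \<in> V" "v \<in> V" "c \<in> V" "d \<in> V"
    using e is_tree_sub[OF T] by blast+
  have neq: "u \<noteq> a" "u \<noteq> b" "u \<noteq> q" "v \<noteq> c" "v \<noteq> d" using tree_edge_neq[OF T] e by metis+
  have neq2: "a \<noteq> c" "a \<noteq> d" "b \<noteq> c" "b \<noteq> d" using ab cd uv by auto
  have neq3: "v \<noteq> a" "v \<noteq> b" using v ab cd(3) by auto
  have neq4: "u \<noteq> c" "u \<noteq> d" using u(1,2) cd(1,2) by auto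
  have neq5: "q \<noteq> c" "q \<noteq> d"
  proof -
    have "u \<in> E `` {q}" using e'(3) by simp
    then show "q \<noteq> c" "q \<noteq> d" using cd(1,2) uv by auto
  qed
  note N = neq neq[symmetric] neq2 neq2[symmetric] neq3 neq3[symmetric] neq4 neq4[symmetric]
    neq5 neq5[symmetric] u(2-4) u(2-4)[symmetric] cd(3) cd(3)[symmetric] uv uv[symmetric]
  \<comment> \<open>Four moves along an edge, each with explicit branches.\<close>
  define E1 where "E1 = move E u b q"
  define E2 where "E2 = move E1 u a q"
  define E3 where "E3 = move E2 q a b"
  have F: "F = move E3 v d c" by (simp add: F_def unfork_def E1_def E2_def E3_def)
  have uq: "u \<in> E `` {q}" using e'(3) by simp
  note M1 = move_tree[OF T e(3,2) u(4), folded E1_def]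
  note T1 = M1(1)
  have I1: "E1 `` {w} = (if w = u then {a, q} else if w = q then insert b (E `` {q})
      else if w = b then {q} else E `` {w})" for w
    using N u(1) ab(2) by (auto simp: E1_def move_Image[OF neq(3,2) u(4)])
  have f1: "(u, q) \<in> E1" "(u, a) \<in> E1"
    using I1[of u] by auto
  note M2 = move_tree[OF T1 f1 u(3), folded E2_def]
  note T2 = M2(1)
  have I2: "E2 `` {w} = (if w = u then {q} else if w = q then insert a (insert b (E `` {q}))
      else if w = b then {q} else if w = a then {q} else E `` {w})" for w
    using N ab(1) I1 by (auto simp: E2_def move_Image[OF neq(3,1) u(3)])
  have f2: "(q, b) \<in> E2" "(q, a) \<in> E2" using I2[of q] N by auto
  note M3 = move_tree[OF T2 f2 u(2)[symmetric], folded E3_def]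
  note T3 = M3(1)
  have aq: "a \<notin> E `` {q}" using ab(1) tree_edge_sym[OF T, of q a] N by auto
  have I3: "E3 `` {w} = (if w = u then {q} else if w = q then insert b (E `` {q})
      else if w = b then {a, q} else if w = a then {b} else E `` {w})" for w
    using N I2 aq by (auto simp: E3_def move_Image[OF u(4,3) u(2)[symmetric]])
  have f3: "(v, c) \<in> E3" "(v, d) \<in> E3" using I3[of v] e(4,5) N by (auto split: if_splits)
  note M4 = move_tree[OF T3 f3 cd(3), folded F]
  show T4: "is_tree V F" by (rule M4(1))
  have I4: "F `` {w} = (if w = v then E3 `` {v} - {d} else if w = c then {v, d}
      else if w = d then {c} else E3 `` {w})" for w
    using N cd(1,2) by (simp add: F move_Image[OF neq(4,5) cd(3)] I3) auto
  show "F `` {b} = {a, q}" "F `` {c} = {v, d}" using N by (simp_all add: I4 I3)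
  have qv: "{a, b, q} = E `` {u}" "r = u" if "q = v"
    using u(1) v uq N that by auto
  show "F `` {q} = (if q = v then {u, b, c} else insert b (E `` {q}))"
  proof (cases "q = v")
    case True
    have "F `` {q} = insert b {c, d, u} - {d}" using True N v qv(2) by (simp add: I4 I3)
    then show ?thesis using True N by auto
  qed (use N in \<open>simp add: I4 I3\<close>)
  then show "F `` {v} = (if q = v then {u, b, c} else {c, r})"
  proof (cases "q = v")
    case False
    show ?thesis using False N v r by (auto simp: I4 I3)
  qed simp
  show "w \<notin> {u, a, b, q, v, c, d} \<Longrightarrow> F `` {w} = E `` {w}" by (simp add: I4 I3)
  have b1: "branch V E u b = {b}" "branch V E u a = {a}" using branch_leaf[OF T] ab by auto
  then have b1': "branch V E u q = V - {u} - {a, b}"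
    using branch_rest[OF T e(3)] u by auto
  have b2: "branch V E1 u a = {a}" by (rule branch_leaf[OF T1]) (use N ab I1 in simp)
  then have b2': "branch V E1 u q = V - {u} - {a}"
    using branch_rest[OF T1 f1(1)] I1[of u] N by auto
  have b3: "branch V E2 q a = {a}" "branch V E2 q b = {b}"
    by (rule branch_leaf[OF T2], use N I2 in simp)+
  have b4: "branch V E3 v d = {d}" "branch V E3 v c = {c}"
    by (rule branch_leaf[OF T3], use N cd I3 in simp)+
  have sums: "sum x (V - {u} - {a, b}) = sum x V - x u - x a - x b"
    "sum x (V - {u} - {a}) = sum x V - x u - x a"
    using fin VV N by (simp_all add: sum_diff)
  note Q = M4(3)[of x] M3(3)[of x] M2(3)[of x] M1(3)[of x]
  note Q' = Q[unfolded b1 b1' b2 b2' b3 b4 sums]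
  show "quad V (rdist F) x
      = quad V (rdist E) x + 2 * ((x c - x a) * sum x V + 4 * x a * x u + (x a)\<^sup>2 - 3 * (x c)\<^sup>2)"
    if "x a = x b" "x c = x d"
    unfolding Q' using that by (simp add: algebra_simps power2_eq_square)
qed

text \<open>
  The vertex \<open>q\<close> now has the neighbours \<open>u\<close> and \<open>b\<close> besides an old one, and \<open>b\<close> is not a leaf. So the
  result is \<open>A\<close> only if \<open>q\<close> has exactly three neighbours and the third one is a leaf, which leaves
  room for five vertices only.
\<close>

lemma unfork_shape:
  assumes T: "is_tree V E" and six: "6 \<le> card V" and u: "E `` {u} = {a, b, q}" "a \<noteq> b" "q \<noteq> a" "q \<noteq> b"
    and ab: "E `` {a} = {u}" "E `` {b} = {u}"
    and cd: "E `` {c} = {v}" "E `` {d} = {v}" "c \<noteq> d" and uv: "u \<noteq> v" and v: "E `` {v} = {c, d, r}"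
    and r: "r \<noteq> c" "r \<noteq> d"
  defines "F \<equiv> unfork E u a b q v c d"
  shows "3 \<le> card (F `` {q})" and "\<not> A_like F"
proof -
  note U = unfork[OF T u ab cd uv v r, folded F_def]
  have uV: "u \<in> V" using u(1) is_tree_sub[OF T] by blast
  have qu: "u \<in> E `` {q}" using tree_edge_sym[OF T, of u q] u(1) by auto
  have N: "u \<noteq> b" "u \<noteq> q" "u \<noteq> a" using tree_edge_neq[OF T, of u] u(1) by auto
  have cb: "c \<noteq> b" "b \<noteq> c" "u \<noteq> c" using cd ab uv u(1,2) by auto
  have bq: "b \<notin> E `` {q}" using ab(2) N(2) tree_edge_sym[OF T, of q b] by auto
  have aq: "a \<notin> E `` {q}" using ab(1) N(2) tree_edge_sym[OF T, of q a] by auto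
  have Fb: "F `` {b} \<noteq> {q}" using U(3) u(3) by auto
  have b: "b \<in> F `` {q}" using U(5) by (cases "q = v") simp_all
  have nonleaf: "3 \<le> card (F `` {q}) \<and> \<not> A_like F" if "3 \<le> card (F `` {q})" "z \<noteq> b" "z \<in> F `` {q}" "F `` {z} \<noteq> {q}" for z
    using not_A_like_nonleaves[OF U(1) that(1) b that(3) _ Fb that(4)] that(1,2) by metis
  have "3 \<le> card (F `` {q}) \<and> \<not> A_like F"
  proof (cases "q = v")
    case True
    have Fq: "F `` {q} = {u, b, c}" using U(5) True by simp
    have "d \<noteq> q" using tree_edge_neq[OF T, of v d] v True by auto
    then have "F `` {c} \<noteq> {q}" using U(4) by auto
    moreover have "3 \<le> card (F `` {q})" using Fq N cb by simp
    ultimately show ?thesis using nonleaf[of c] Fq cb by simp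
  next
    case False
    then have Fq: "F `` {q} = insert b (E `` {q})" using U(5) by simp
    have "E `` {q} \<noteq> {u}"
    proof
      assume "E `` {q} = {u}"
      then have "E `` {u, a, b, q} \<subseteq> {u, a, b, q}" using u(1) ab by blast
      moreover have "card {u, a, b, q} \<le> 5" by (simp add: card_insert_if)
      ultimately show False using small_closed[OF T six uV, of "{u, a, b, q}"] by blast
    qed
    then obtain z where z: "z \<in> E `` {q}" "z \<noteq> u" using qu by blast
    have zb: "z \<noteq> b" "z \<noteq> a" using z(1) bq aq by auto
    have card: "3 \<le> card (F `` {q})"
    proof -
      have "{b, u, z} \<subseteq> F `` {q}" using Fq qu z(1) by blast
      then have "card {b, u, z} \<le> card (F `` {q})"
        using card_mono[OF tree_finite_nbrs[OF U(1)]] by blast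
      then show ?thesis using zb N(1) z(2) by auto
    qed
    have qz: "q \<in> E `` {z}" using tree_edge_sym[OF T, of q z] z(1) by simp
    have zq: "z \<noteq> q" using tree_edge_neq[OF T, of q z] z(1) by auto
    have zcd: "z \<noteq> c" "z \<noteq> d" using qz cd(1,2) False by auto
    show ?thesis
    proof (cases "z = v \<or> E `` {z} \<noteq> {q}")
      case True
      have "F `` {z} \<noteq> {q}"
      proof (cases "z = v")
        case True
        have "q \<noteq> c" using cd(1) qu uv by auto
        then show ?thesis using U(6) False True by auto
      next
        case nv: False
        then show ?thesis using U(7)[of z] True z(2) zb zq zcd by simp
      qed
      moreover have "z \<in> F `` {q}" using z(1) Fq by blast
      ultimately show ?thesis using nonleaf[OF card zb(1)] by simp
    next
      case leaf: False
      \<comment> \<open>Either \<open>u\<close> and the leaf \<open>z\<close> are all neighbours of \<open>q\<close>, which gives five vertices in total,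
        or the new degree of \<open>q\<close> is at least four.\<close>
      show ?thesis
      proof (cases "E `` {q} = {u, z}")
        case True
        have "E `` {u, a, b, q, z} \<subseteq> {u, a, b, q, z}" using u(1) ab leaf True by blast
        moreover have "card {u, a, b, q, z} \<le> 5" by (simp add: card_insert_if)
        ultimately show ?thesis using small_closed[OF T six uV, of "{u, a, b, q, z}"] by blast
      next
        case False
        then obtain y where y: "y \<in> E `` {q}" "y \<noteq> u" "y \<noteq> z" using qu z(1) by blast
        then have "y \<noteq> b" using bq by blast
        have "{b, u, z, y} \<subseteq> F `` {q}" using Fq qu z(1) y(1) by blast
        then have "card {b, u, z, y} \<le> card (F `` {q})"
          using card_mono[OF tree_finite_nbrs[OF U(1)]] by blast
        then have "4 \<le> card (F `` {q})" using zb N(1) z(2) y \<open>y \<noteq> b\<close> by auto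
        then show ?thesis using not_A_like_4[of F q] card by simp
      qed
    qed
  qed
  then show "3 \<le> card (F `` {q})" "\<not> A_like F" by simp_all
qed

text \<open>
  The two gains, for straightening the fork at \<open>u\<close> and the one at \<open>v\<close>, may have either sign, because of
  the opposite terms \<open>\<plusminus> s\<close>. They cancel in the sum, which is positive by \<open>fork_weights\<close>, so one of
  the two trees is better.
\<close>

lemma better_tree_two_forks:
  assumes T: "is_tree V E" and six: "6 \<le> card V" and uv: "u \<noteq> v"
    and u: "card (E `` {u}) = 3" and ab: "a \<noteq> b" "E `` {a} = {u}" "E `` {b} = {u}"
    and v: "card (E `` {v}) = 3" and cd: "c \<noteq> d" "E `` {c} = {v}" "E `` {d} = {v}"
  shows "\<exists>F. improves_off_A V E F"
proof -
  have "a \<in> E `` {u}" "b \<in> E `` {u}"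
    using remove_leaf(2)[OF T ab(2)] remove_leaf(2)[OF T ab(3)] by simp_all
  then obtain q where q: "E `` {u} = {a, b, q}" "q \<noteq> a" "q \<noteq> b" by (rule three_neighbours[OF u _ _ ab(1)])
  have "c \<in> E `` {v}" "d \<in> E `` {v}"
    using remove_leaf(2)[OF T cd(2)] remove_leaf(2)[OF T cd(3)] by simp_all
  then obtain r where r: "E `` {v} = {c, d, r}" "r \<noteq> c" "r \<noteq> d" by (rule three_neighbours[OF v _ _ cd(1)])
  note fin = is_tree_finite[OF T]
  have V: "finite V" "2 \<le> card V" using six fin by auto
  obtain x where \<mu>: "0 < radius V E" and "\<forall>w\<in>V. 0 < x w"
    and "\<forall>w\<in>V. (\<Sum>y\<in>V. rdist E w y * x y) = radius V E * x w"
    using sym_connected_perron_vector[OF V is_tree_sym_connected[OF T]] by blast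
  note x = bspec[OF this(2)] and ev = bspec[OF this(3)]
  note Wu = fork_weights[OF T ab(2,3,1) \<mu> x ev] and Wv = fork_weights[OF T cd(2,3,1) \<mu> x ev]
  let ?F = "unfork E u a b q v c d" and ?G = "unfork E v c d r u a b"
  note F = unfork[OF T q(1) ab(1) q(2,3) ab(2,3) cd(2,3,1) uv r]
    and G = unfork[OF T r(1) cd(1) r(2,3) cd(2,3) ab(2,3,1) uv[symmetric] q]
  have V': "u \<in> V" "a \<in> V" "c \<in> V"
    using remove_leaf(3,4)[OF T ab(2)] remove_leaf(4)[OF T cd(2)] by simp_all
  define s where "s = (x c - x a) * sum x V"
  define p where "p = x a * (2 * x u - x a)"
  define p' where "p' = x c * (2 * x v - x c)"
  have "0 < p" "0 < p'" using Wu(2) Wv(2) x[OF V'(2)] x[OF V'(3)] by (simp_all add: p_def p'_def)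
  then have "0 < s + 4 * x a * x u + (x a)\<^sup>2 - 3 * (x c)\<^sup>2 \<or> 0 < - s + 4 * x c * x v + (x c)\<^sup>2 - 3 * (x a)\<^sup>2"
    by (simp add: p_def p'_def algebra_simps power2_eq_square) linarith
  then have "quad V (rdist E) x < quad V (rdist ?F) x \<or> quad V (rdist E) x < quad V (rdist ?G) x"
    using F(2)[OF Wu(1) Wv(1)] G(2)[OF Wv(1) Wu(1)] by (auto simp: s_def algebra_simps)
  moreover have "quad V (rdist E) x = radius V E * (\<Sum>v\<in>V. (x v)\<^sup>2)"
    using ev by (intro quad_eigenvector) auto
  moreover have "radius V E < radius V H"
    if "is_tree V H" "radius V E * (\<Sum>v\<in>V. (x v)\<^sup>2) < quad V (rdist H) x" for H
    using radius_less_quad[of V H u x "radius V E"] fin is_tree_sym[OF that(1)] V'(1) x[OF V'(1)] that(2)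
    by simp
  ultimately have "radius V E < radius V ?F \<or> radius V E < radius V ?G"
    using F(1) G(1) by metis
  then show ?thesis
    unfolding improves_off_A_def
    using F(1) G(1) unfork_shape[OF T six q(1) ab(1) q(2,3) ab(2,3) cd(2,3,1) uv r]
      unfork_shape[OF T six r(1) cd(1) r(2,3) cd(2,3) ab(2,3,1) uv[symmetric] q]
    by metis
qed

lemma better_than_B_like:
  assumes T: "is_tree V E" and six: "6 \<le> card V" and deg: "3 \<le> card (E `` {u})"
    and A: "\<not> A_like E" and B: "\<not> B_like E"
  shows "\<exists>F. improves_off_A V E F"
proof (rule ccontr)
  assume none: "\<nexists>F. improves_off_A V E F"
  have fork: "card (E `` {w}) = 3 \<and> (\<exists>a b. a \<noteq> b \<and> E `` {a} = {w} \<and> E `` {b} = {w})"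
    if "3 \<le> card (E `` {w})" for w
    using better_tree_at_vertex[OF T six that A B] none by blast
  obtain a b where ab: "card (E `` {u}) = 3" "a \<noteq> b" "E `` {a} = {u}" "E `` {b} = {u}"
    using fork[OF deg] by blast
  obtain v where v: "v \<noteq> u" "\<not> card (E `` {v}) \<le> 2"
    using A ab unfolding A_like_def by blast
  then have "3 \<le> card (E `` {v})" by linarith
  then obtain c d where "card (E `` {v}) = 3" "c \<noteq> d" "E `` {c} = {v}" "E `` {d} = {v}"
    using fork by blast
  then show False using better_tree_two_forks[OF T six _ ab(1,2,3,4), of v c d] v(1) none by blast
qed

section \<open>From graphs to edge relations\<close>

lemma awalk_relpow:
  assumes "pre_digraph.awalk (with_proj G) u p v"
  shows "(u, v) \<in> parcs G ^^ length p"
proof -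
  have "set p \<subseteq> parcs G" "pcas u p v"
    using assms by (auto simp: pre_digraph.awalk_def cas_with_proj_eq)
  then show ?thesis
  proof (induction p arbitrary: u)
    case (Cons e p)
    then have "(u, snd e) \<in> parcs G" "(snd e, v) \<in> parcs G ^^ length p" by (cases e, auto)+
    then show ?case unfolding length_Cons by (rule relpow_Suc_I2)
  qed simp
qed

lemma relpow_awalk:
  assumes "u \<in> pverts G" "(u, v) \<in> parcs G ^^ k" "parcs G \<subseteq> pverts G \<times> pverts G"
  shows "\<exists>p. pre_digraph.awalk (with_proj G) u p v \<and> length p = k"
  using assms(1,2)
proof (induction k arbitrary: u)
  case 0
  then show ?case by (auto simp: pre_digraph.awalk_def cas_with_proj_eq)
next
  case (Suc k)
  obtain w where w: "(u, w) \<in> parcs G" "(w, v) \<in> parcs G ^^ k"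
    using Suc.prems(2) by (metis relpow_Suc_E2)
  then have "w \<in> pverts G" using assms(3) by blast
  then obtain p where p: "pre_digraph.awalk (with_proj G) w p v" "length p = k"
    using Suc.IH w(2) by blast
  then have "pre_digraph.awalk (with_proj G) u ((u, w) # p) v"
    using w(1) Suc.prems(1) by (auto simp: pre_digraph.awalk_def cas_with_proj_eq)
  then show ?case using p(2) by (intro exI[of _ "(u, w) # p"]) simp
qed

text \<open>
  Paths may be replaced by walks because a shortest walk repeats no vertex: a repetition could be cut
  out.
\<close>

lemma graph_dist_gdist:
  assumes J: "sym_connected (pverts G) (parcs G)" and u: "u \<in> pverts G" and v: "v \<in> pverts G"
  shows "graph_dist G u v = gdist (parcs G) u v"
proof -
  have sub: "parcs G \<subseteq> pverts G \<times> pverts G" using J by (simp add: sym_connected_def)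
  interpret pair_wf_digraph G using sub by unfold_locales auto
  obtain p where p: "awalk u p v" "length p = gdist (parcs G) u v"
    using relpow_awalk[OF u gdist_walk[OF J u v] sub] by blast
  have short: "gdist (parcs G) u v \<le> length q" if "awalk u q v" for q
    using awalk_relpow[OF that] by (rule gdist_le)
  have "distinct (pawalk_verts u p)"
  proof (rule ccontr)
    assume "\<not> ?thesis"
    then obtain q r s w where "p = q @ r @ s" "0 < length r" "awalk u q w" "awalk w s v"
      using awalk_not_distinct_decomp[OF p(1)] by blast
    then show False using short[of "q @ s"] p(2) by (simp del: length_greater_0_conv)
  qed
  then have "apath u p v" using p(1) by (simp add: apath_def)
  then show ?thesis
    unfolding graph_dist_def using p(2) short awalkI_apath
    by (intro Least_equality) blast+
qed

lemma pair_graph_sym_connected: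
  assumes "pair_graph G" "Digraph_Component.connected (with_proj G)"
  shows "sym_connected (pverts G) (parcs G)" "finite (pverts G)" "pverts G \<noteq> {}"
proof -
  interpret pair_graph G by fact
  have sc: "strongly_connected (with_proj (mk_symmetric (with_proj G)))"
    using assms(2) unfolding connected_def .
  then show "pverts G \<noteq> {}" by (simp add: strongly_connected_def mk_symmetric_def)
  show "finite (pverts G)" by (rule pair_finite_verts)
  show "sym_connected (pverts G) (parcs G)"
    unfolding sym_connected_def
  proof (intro conjI ballI)
    show "parcs G \<subseteq> pverts G \<times> pverts G" using wellformed' by auto
    show "sym (parcs G)" using arcs_symmetric by (auto simp: sym_def)
    fix u v assume "u \<in> pverts G" "v \<in> pverts G"
    then have "u \<rightarrow>\<^sup>*\<^bsub>with_proj (mk_symmetric (with_proj G))\<^esub> v"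
      using sc by (simp add: strongly_connected_def mk_symmetric_def)
    then have "u \<rightarrow>\<^sup>*\<^bsub>with_proj G\<^esub> v" using reachable_mk_symmetric_eq[OF pair_sym_arcs] by simp
    then have "\<exists>p. awalk u p v" by (simp only: reachable_awalk)
    then obtain p where "awalk u p v" ..
    from awalk_relpow[OF this] show "\<exists>k. (u, v) \<in> parcs G ^^ k" ..
  qed
qed

text \<open>
  The bijection \<open>e\<close> that enumerates the vertices translates between vectors indexed by numbers and
  functions on the vertices; every eigenvalue is bounded by the form.
\<close>

lemma rho_radius:
  assumes J: "sym_connected (pverts G) (parcs G)" and fin: "finite (pverts G)" and ne: "pverts G \<noteq> {}"
  shows "\<rho> G = radius (pverts G) (parcs G)"
proof -
  define V where "V = pverts G"
  define E where "E = parcs G"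
  define n where "n = card V"
  define e where "e = from_nat_into V"
  define M where "M = distance_matrix G"
  have e: "bij_betw e {..<n} V"
    unfolding e_def n_def V_def using bij_betw_from_nat_into_finite[OF fin] .
  have M: "M \<in> carrier_mat n n" by (simp add: M_def distance_matrix_def n_def V_def)
  have Mij: "M $$ (i, j) = rdist E (e i) (e j)" if "i < n" "j < n" for i j
    using that graph_dist_gdist[OF J] bij_betwE[OF e]
    by (auto simp: M_def distance_matrix_def n_def V_def E_def e_def)
  have row: "(M *\<^sub>v w) $ i = (\<Sum>v\<in>V. rdist E (e i) v * y v)"
    if i: "i < n" and w: "w \<in> carrier_vec n" and y: "\<And>j. j < n \<Longrightarrow> y (e j) = w $ j" for w y i
  proof -
    have "(M *\<^sub>v w) $ i = (\<Sum>j<n. M $$ (i, j) * w $ j)"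
      using i w M by (simp add: scalar_prod_def lessThan_atLeast0)
    also have "\<dots> = (\<Sum>j<n. rdist E (e i) (e j) * y (e j))"
      using i y by (intro sum.cong) (auto simp: Mij)
    also have "\<dots> = (\<Sum>v\<in>V. rdist E (e i) v * y v)"
      by (rule sum.reindex_bij_betw[OF e])
    finally show ?thesis .
  qed
  have top: "top_eigenvalue V (rdist E) (radius V E)"
    unfolding V_def E_def using radius_top_eigenvalue[OF fin ne] J by (simp add: sym_connected_def)
  have "Max (spectrum M) = radius V E"
  proof (rule Max_eqI)
    show "finite (spectrum M)" using card_finite_spectrum(1)[OF M] .
    obtain x v where v: "v \<in> V" "x v \<noteq> 0" and ev: "\<forall>u\<in>V. (\<Sum>v\<in>V. rdist E u v * x v) = radius V E * x u"
      using top unfolding top_eigenvalue_def by blast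
    define w where "w = vec n (\<lambda>i. x (e i))"
    obtain j where j: "j < n" "e j = v" using e v(1) by (auto simp: bij_betw_def)
    have wj: "w $ j = x v" using j by (simp add: w_def)
    have "w \<noteq> 0\<^sub>v n"
    proof
      assume "w = 0\<^sub>v n"
      then show False using wj v(2) j(1) by simp
    qed
    moreover have "M *\<^sub>v w = radius V E \<cdot>\<^sub>v w"
    proof (rule eq_vecI)
      fix i assume "i < dim_vec (radius V E \<cdot>\<^sub>v w)"
      then have i: "i < n" by (simp add: w_def)
      then have "e i \<in> V" using bij_betwE[OF e] by blast
      then show "(M *\<^sub>v w) $ i = (radius V E \<cdot>\<^sub>v w) $ i"
        using row[OF i, of w x] ev i by (simp add: w_def)
    qed (use M in \<open>simp add: w_def\<close>)
    ultimately have "eigenvector M w (radius V E)"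
      unfolding eigenvector_def using M by (simp add: w_def)
    then show "radius V E \<in> spectrum M" by (auto simp: spectrum_def eigenvalue_def)
  next
    fix k assume "k \<in> spectrum M"
    then obtain w where w: "w \<in> carrier_vec n" "w \<noteq> 0\<^sub>v n" "M *\<^sub>v w = k \<cdot>\<^sub>v w"
      using M by (auto simp: spectrum_def eigenvalue_def eigenvector_def)
    define y where "y v = w $ (the_inv_into {..<n} e v)" for v
    have y: "y (e j) = w $ j" if "j < n" for j
      using that e by (simp add: y_def bij_betw_def the_inv_into_f_f)
    have ev: "(\<Sum>v\<in>V. rdist E u v * y v) = k * y u" if uV: "u \<in> V" for u
    proof -
      obtain i where i: "i < n" "e i = u" using e uV by (auto simp: bij_betw_def)
      then show ?thesis using row[OF i(1) w(1) y] w(1,3) y[OF i(1)] by auto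
    qed
    have "k * (\<Sum>v\<in>V. (y v)\<^sup>2) = quad V (rdist E) y"
      using ev quad_eigenvector[of V "rdist E" y k] by simp
    also have "\<dots> \<le> radius V E * (\<Sum>v\<in>V. (y v)\<^sup>2)"
      using top unfolding top_eigenvalue_def by blast
    finally have "k * (\<Sum>v\<in>V. (y v)\<^sup>2) \<le> radius V E * (\<Sum>v\<in>V. (y v)\<^sup>2)" .
    moreover obtain j where j: "j < n" "w $ j \<noteq> 0"
      using w(1,2) by (metis carrier_vecD eq_vecI index_zero_vec(1) index_zero_vec(2))
    then have "e j \<in> V" "y (e j) \<noteq> 0" using bij_betwE[OF e] y by auto
    then have "0 < (\<Sum>v\<in>V. (y v)\<^sup>2)" using fin sum_squares_pos[of V "e j" y] by (simp add: V_def)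
    ultimately show "k \<le> radius V E" by simp
  qed
  then show ?thesis by (simp add: distance_spectral_radius_def M_def V_def E_def)
qed

lemma graph_isoI:
  assumes "parcs G \<subseteq> pverts G \<times> pverts G" "inj_on f (pverts G)"
    "pverts H = f ` pverts G" "parcs H = map_prod f f ` parcs G"
  shows "G \<cong>\<^sub>g H"
proof -
  interpret pair_wf_digraph G using assms(1) by unfold_locales auto
  let ?h = "\<lparr>iso_verts = f, iso_arcs = map_prod f f, iso_head = snd, iso_tail = fst\<rparr>"
  have "inj_on (map_prod f f) (parcs G)"
    using map_prod_inj_on[OF assms(2,2)] assms(1) by (rule inj_on_subset)
  moreover have "wf_digraph (with_proj G)" by unfold_locales
  ultimately have "digraph_isomorphism ?h"
    unfolding digraph_isomorphism_def using assms(2) by auto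
  moreover have "with_proj H = app_iso ?h (with_proj G)"
    using assms(3,4) by (simp add: app_iso_def with_proj_def)
  ultimately show ?thesis unfolding digraph_iso_def by blast
qed

lemma graph_isoE:
  assumes "G \<cong>\<^sub>g H"
  obtains f where "inj_on f (pverts G)" "pverts H = f ` pverts G" "parcs H = map_prod f f ` parcs G"
proof -
  obtain h where h: "pre_digraph.digraph_isomorphism (with_proj G) h" "with_proj H = app_iso h (with_proj G)"
    using assms unfolding digraph_iso_def by blast
  have eq: "pverts H = iso_verts h ` pverts G" "parcs H = iso_arcs h ` parcs G"
    "iso_tail h = fst" "iso_head h = snd"
    using h(2) by (simp_all add: app_iso_def with_proj_def)
  have "iso_arcs h a = map_prod (iso_verts h) (iso_verts h) a" if "a \<in> parcs G" for a
  proof -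
    have "iso_verts h (fst a) = fst (iso_arcs h a)" "iso_verts h (snd a) = snd (iso_arcs h a)"
      using h(1) that unfolding pre_digraph.digraph_isomorphism_def eq(3,4) by simp_all
    then show ?thesis by (intro prod_eqI) simp_all
  qed
  then have "parcs H = map_prod (iso_verts h) (iso_verts h) ` parcs G"
    unfolding eq(2) by (rule image_cong[OF refl])
  moreover have "inj_on (iso_verts h) (pverts G)"
    using h(1) by (simp add: pre_digraph.digraph_isomorphism_def)
  ultimately show ?thesis using eq(1) that by blast
qed

lemma relpow_map:
  assumes inj: "inj_on f V" and sub: "E \<subseteq> V \<times> V" and u: "u \<in> V" and v: "v \<in> V"
  shows "(f u, f v) \<in> (map_prod f f ` E) ^^ k \<longleftrightarrow> (u, v) \<in> E ^^ k"
  using v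
proof (induction k arbitrary: v)
  case 0
  then show ?case using inj_on_eq_iff[OF inj u] by simp
next
  case (Suc k)
  show ?case
  proof
    assume "(f u, f v) \<in> (map_prod f f ` E) ^^ Suc k"
    then obtain z where z: "(f u, z) \<in> (map_prod f f ` E) ^^ k" "(z, f v) \<in> map_prod f f ` E"
      by (rule relpow_Suc_E)
    then obtain a b where ab: "(a, b) \<in> E" "z = f a" "f v = f b" by auto
    then have "a \<in> V" "b \<in> V" using sub by auto
    then have "v = b" using ab(3) inj_on_eq_iff[OF inj Suc.prems] by simp
    then show "(u, v) \<in> E ^^ Suc k" using Suc.IH[OF \<open>a \<in> V\<close>] z(1) ab by auto
  next
    assume "(u, v) \<in> E ^^ Suc k"
    then obtain a where a: "(u, a) \<in> E ^^ k" "(a, v) \<in> E" by auto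
    then have "a \<in> V" using sub by auto
    then have "(f u, f a) \<in> (map_prod f f ` E) ^^ k" using Suc.IH a(1) by blast
    moreover have "(f a, f v) \<in> map_prod f f ` E" using a(2) by force
    ultimately show "(f u, f v) \<in> (map_prod f f ` E) ^^ Suc k" by (rule relpow_Suc_I)
  qed
qed

lemma radius_map:
  assumes inj: "inj_on f V" and sub: "E \<subseteq> V \<times> V" and V: "finite V" "V \<noteq> {}" and sym: "sym E"
  shows "radius (f ` V) (map_prod f f ` E) = radius V E"
proof (rule radius_eqI)
  show "finite (f ` V)" using V by simp
  let ?F = "map_prod f f ` E"
  define g where "g = the_inv_into V f"
  have g: "g (f v) = v" if "v \<in> V" for v using that inj by (simp add: g_def the_inv_into_f_f)
  have d: "gdist ?F (f u) (f v) = gdist E u v" if "u \<in> V" "v \<in> V" for u v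
    unfolding gdist_def using relpow_map[OF inj sub that] by simp
  have top: "top_eigenvalue V (rdist E) (radius V E)" by (rule radius_top_eigenvalue[OF V sym])
  have 1: "quad (f ` V) (rdist ?F) y \<le> radius V E * (\<Sum>v\<in>f ` V. (y v)\<^sup>2)" for y
  proof -
    have "quad (f ` V) (rdist ?F) y = quad V (rdist E) (\<lambda>v. y (f v))"
      unfolding quad_def by (simp add: sum.reindex[OF inj] d)
    also have "\<dots> \<le> radius V E * (\<Sum>v\<in>V. (y (f v))\<^sup>2)"
      using top unfolding top_eigenvalue_def by blast
    finally show ?thesis by (simp add: sum.reindex[OF inj])
  qed
  obtain x where x: "\<forall>v\<in>V. 0 \<le> x v" "\<exists>v\<in>V. x v \<noteq> 0"
    "\<forall>u\<in>V. (\<Sum>v\<in>V. rdist E u v * x v) = radius V E * x u"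
    using top unfolding top_eigenvalue_def by blast
  have "\<forall>u\<in>f ` V. (\<Sum>v\<in>f ` V. rdist ?F u v * x (g v)) = radius V E * x (g u)"
    using x(3) by (simp add: sum.reindex[OF inj] d g)
  moreover have "\<forall>v\<in>f ` V. 0 \<le> x (g v)" "\<exists>v\<in>f ` V. x (g v) \<noteq> 0" using x(1,2) by (simp_all add: g)
  ultimately show "top_eigenvalue (f ` V) (rdist ?F) (radius V E)"
    unfolding top_eigenvalue_def using 1 by (intro conjI allI exI[of _ "\<lambda>v. x (g v)"]) simp_all
qed

lemma sym_connected_map:
  assumes J: "sym_connected V E" and inj: "inj_on f V"
  shows "sym_connected (f ` V) (map_prod f f ` E)"
  unfolding sym_connected_def
proof (intro conjI ballI)
  have sub: "E \<subseteq> V \<times> V" and sym: "sym E" using J by (auto simp: sym_connected_def)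
  show "map_prod f f ` E \<subseteq> f ` V \<times> f ` V" using sub by auto
  show "sym (map_prod f f ` E)" using sym by (force simp: sym_def)
  fix y z assume "y \<in> f ` V" "z \<in> f ` V"
  then obtain u v where "u \<in> V" "v \<in> V" "y = f u" "z = f v" by blast
  then show "\<exists>k. (y, z) \<in> (map_prod f f ` E) ^^ k"
    using relpow_map[OF inj sub] gdist_walk[OF J] by metis
qed

lemma rho_iso:
  assumes J: "sym_connected (pverts G) (parcs G)" and fin: "finite (pverts G)" and ne: "pverts G \<noteq> {}"
    and iso: "G \<cong>\<^sub>g H"
  shows "\<rho> H = \<rho> G"
proof -
  obtain f where f: "inj_on f (pverts G)" "pverts H = f ` pverts G" "parcs H = map_prod f f ` parcs G"
    using graph_isoE[OF iso] by blast
  have "\<rho> H = radius (pverts H) (parcs H)"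
    using sym_connected_map[OF J f(1)] fin ne f(2,3) by (intro rho_radius) auto
  also have "\<dots> = radius (pverts G) (parcs G)"
    unfolding f(2,3) using J by (intro radius_map[OF f(1) _ fin ne]) (auto simp: sym_connected_def)
  finally show ?thesis using rho_radius[OF J fin ne] by simp
qed

lemma rho_tree:
  assumes "is_tree (pverts G) (parcs G)"
  shows "\<rho> G = radius (pverts G) (parcs G)"
  using is_tree_sym_connected[OF assms] is_tree_finite[OF assms] by (intro rho_radius) auto

section \<open>Spanning trees and edge counts\<close>

text \<open>
  A maximal vertex set carrying a subtree is closed under adjacency, for otherwise an edge
  leaving it would extend the tree.
\<close>

lemma spanning_tree:
  assumes J: "sym_connected V E" and fin: "finite V" and ne: "V \<noteq> {}"
  shows "\<exists>F. F \<subseteq> E \<and> is_tree V F"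
proof -
  have sub: "E \<subseteq> V \<times> V" and sym: "sym E" using J by (auto simp: sym_connected_def)
  define S where "S = {U. U \<subseteq> V \<and> (\<exists>F. F \<subseteq> E \<and> is_tree U F)}"
  obtain v where "v \<in> V" using ne by blast
  then have "{v} \<in> S" using is_tree.single[of v] by (auto simp: S_def)
  moreover have "finite S" using fin by (simp add: S_def)
  ultimately obtain U where U: "U \<in> S" and max: "\<And>W. W \<in> S \<Longrightarrow> U \<subseteq> W \<Longrightarrow> U = W"
    using finite_has_maximal[of S] by auto
  obtain F where F: "U \<subseteq> V" "F \<subseteq> E" "is_tree U F" using U by (auto simp: S_def)
  have "E `` U \<subseteq> U"
  proof (rule ccontr)
    assume "\<not> E `` U \<subseteq> U"
    then obtain a b where ab: "a \<in> U" "(a, b) \<in> E" "b \<notin> U" by blast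
    have "is_tree (U \<union> {b}) (F \<union> {} \<union> bridge a b)"
      using is_tree.join[OF F(3) is_tree.single[of b] _ ab(1)] ab(3) by simp
    moreover have "F \<union> {} \<union> bridge a b \<subseteq> E"
      using F(2) ab(2) symD[OF sym] by (auto simp: bridge_def)
    moreover have "U \<union> {b} \<subseteq> V" using F(1) ab(2) sub by blast
    ultimately have "U \<union> {b} \<in> S" unfolding S_def by blast
    then show False using max[of "U \<union> {b}"] ab(3) by blast
  qed
  moreover obtain u where u: "u \<in> U" using is_tree_finite[OF F(3)] by blast
  ultimately have "V \<subseteq> U"
    using sym_connected_closed[OF J] F(1) by blast
  then show ?thesis using F by auto
qed

definition undirected :: "'a rel \<Rightarrow> 'a set set" where
  "undirected E = (\<lambda>(u, v). {u, v}) ` E"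

lemma is_tree_card_edges: "is_tree V E \<Longrightarrow> Suc (card (undirected E)) = card V"
proof (induction rule: is_tree.induct)
  case (join V1 E1 V2 E2 a b)
  have sub: "e \<subseteq> V1" "e \<noteq> {}" if "e \<in> undirected E1" for e
    using that is_tree_sub[OF join.hyps(1)] by (auto simp: undirected_def)
  have sub2: "e \<subseteq> V2" "e \<noteq> {}" if "e \<in> undirected E2" for e
    using that is_tree_sub[OF join.hyps(2)] by (auto simp: undirected_def)
  have fin: "finite (undirected E1)" "finite (undirected E2)"
    using is_tree_edges_finite join.hyps(1,2) by (auto simp: undirected_def)
  have "undirected (E1 \<union> E2 \<union> bridge a b) = insert {a, b} (undirected E1 \<union> undirected E2)"
    by (auto simp: undirected_def bridge_def)
  moreover have "{a, b} \<notin> undirected E1 \<union> undirected E2"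
    using sub[of "{a, b}"] sub2[of "{a, b}"] join.hyps(3-5) by blast
  moreover have "e \<notin> undirected E2" if "e \<in> undirected E1" for e
    using sub[OF that] sub2[of e] join.hyps(3) by blast
  then have "undirected E1 \<inter> undirected E2 = {}" by blast
  ultimately have "card (undirected (E1 \<union> E2 \<union> bridge a b)) = Suc (card (undirected E1) + card (undirected E2))"
    using fin by (simp add: card_Un_disjoint)
  moreover have "card (V1 \<union> V2) = card V1 + card V2"
    using is_tree_finite[OF join.hyps(1)] is_tree_finite[OF join.hyps(2)] join.hyps(3)
    by (simp add: card_Un_disjoint)
  ultimately show ?case using join.IH by simp
qed (simp add: undirected_def)

lemma undirected_iff:
  assumes "sym E"
  shows "{u, v} \<in> undirected E \<longleftrightarrow> (u, v) \<in> E"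
proof
  assume "{u, v} \<in> undirected E"
  then obtain u' v' where e: "(u', v') \<in> E" "{u, v} = {u', v'}" by (auto simp: undirected_def)
  then have "(v', u') \<in> E" using symD[OF assms] by blast
  then show "(u, v) \<in> E" using e by (auto simp: doubleton_eq_iff)
next
  assume "(u, v) \<in> E"
  then show "{u, v} \<in> undirected E"
    unfolding undirected_def by (rule rev_image_eqI) simp
qed

lemma undirected_inject:
  assumes "sym E" "sym F" "undirected E = undirected F"
  shows "E = F"
proof -
  have "(u, v) \<in> E \<longleftrightarrow> (u, v) \<in> F" for u v
    using undirected_iff[OF assms(1), of u v] undirected_iff[OF assms(2), of u v] assms(3) by simp
  then show ?thesis by (intro subset_antisym subrelI) simp_all
qed

section \<open>The extremal graphs\<close>

lemma path_graph_parcs: "parcs (path_graph n) = (\<Union>i\<in>{1..<n}. bridge i (Suc i))"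
  by (fastforce simp: path_graph_def bridge_def)

lemma path_graph_Suc: "1 \<le> n \<Longrightarrow> parcs (path_graph (Suc n)) = parcs (path_graph n) \<union> {} \<union> bridge n (Suc n)"
  unfolding path_graph_parcs by (simp add: atLeastLessThanSuc Un_commute)

lemma path_graph_verts [simp]: "pverts (path_graph n) = {1..n}"
  by (simp add: path_graph_def)

lemma path_graph_tree: "1 \<le> n \<Longrightarrow> is_tree {1..n} (parcs (path_graph n))"
proof (induction n rule: dec_induct)
  case base
  have "parcs (path_graph 1) = {}" by (simp add: path_graph_parcs)
  then show ?case using is_tree.single[of "1::nat"] by simp
next
  case (step n)
  have "is_tree ({1..n} \<union> {Suc n}) (parcs (path_graph n) \<union> {} \<union> bridge n (Suc n))"
    using step.hyps by (intro is_tree.join[OF step.IH is_tree.single]) auto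
  moreover have "{1..n} \<union> {Suc n} = {1..Suc n}" by auto
  ultimately show ?case unfolding path_graph_Suc[OF step.hyps(1)] by simp
qed

lemma pendant_parcs: "parcs (add_pendant G w u) = parcs G \<union> {} \<union> bridge u w"
  and pendant_verts: "pverts (add_pendant G w u) = pverts G \<union> {w}"
  by (auto simp: add_pendant_def bridge_def)

lemma pendant_tree:
  assumes "1 \<le> n" "u \<in> {1..n}"
  shows "is_tree ({1..n} \<union> {Suc n}) (parcs (add_pendant (path_graph n) (Suc n) u))"
  unfolding pendant_parcs
  by (rule is_tree.join[OF path_graph_tree[OF assms(1)] is_tree.single]) (use assms in auto)

lemma path_iso:
  assumes xs: "distinct xs"
  obtains f where "inj_on f (set xs)" "f ` set xs = {1..length xs}"
    "map_prod f f ` path_edges xs = parcs (path_graph (length xs))"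
    "\<And>i. i < length xs \<Longrightarrow> f (xs ! i) = Suc i"
proof -
  define f where "f x = Suc (the_inv_into {..<length xs} ((!) xs) x)" for x
  have inj: "inj_on ((!) xs) {..<length xs}" using xs by (auto simp: inj_on_def nth_eq_iff_index_eq)
  have f: "f (xs ! i) = Suc i" if "i < length xs" for i
    using the_inv_into_f_f[OF inj, of i] that by (simp add: f_def)
  have set: "set xs = (!) xs ` {..<length xs}" by (auto simp: set_conv_nth)
  have "inj_on f (set xs)" unfolding set by (rule inj_onI) (auto simp: f)
  moreover have "f ` set xs = Suc ` {..<length xs}" unfolding set image_image by (rule image_cong) (auto simp: f)
  moreover have "Suc ` {..<length xs} = {1..length xs}" by (auto simp: image_Suc_lessThan)
  moreover have "map_prod f f ` path_edges xs = parcs (path_graph (length xs))"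
  proof -
    have "map_prod f f ` path_edges xs = (\<Union>i\<in>{i. Suc i < length xs}. bridge (f (xs ! i)) (f (xs ! Suc i)))"
      unfolding path_edges_nth image_UN by (simp add: bridge_def)
    also have "\<dots> = (\<Union>i\<in>{i. Suc i < length xs}. bridge (Suc i) (Suc (Suc i)))"
      by (intro SUP_cong refl) (simp add: f)
    also have "\<dots> = (\<Union>i\<in>Suc ` {i. Suc i < length xs}. bridge i (Suc i))" by simp
    also have "Suc ` {i. Suc i < length xs} = {1..<length xs}"
      by (auto simp: image_iff gr0_conv_Suc Suc_le_eq)
    finally show ?thesis by (simp add: path_graph_parcs)
  qed
  ultimately show ?thesis using that f by metis
qed

lemma path_graph_iso:
  assumes "distinct xs" "pverts G = set xs" "parcs G = path_edges xs"
  shows "G \<cong>\<^sub>g path_graph (length xs)"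
proof -
  obtain f where f: "inj_on f (set xs)" "f ` set xs = {1..length xs}"
    "map_prod f f ` path_edges xs = parcs (path_graph (length xs))"
    using path_iso[OF assms(1)] by metis
  then show ?thesis using assms(2,3) path_edges_sub[of xs] by (intro graph_isoI[where f = f]) auto
qed

lemma pendant_iso:
  assumes xs: "distinct xs" "a \<notin> set xs" "k < length xs"
    and G: "pverts G = insert a (set xs)" "parcs G = path_edges xs \<union> bridge (xs ! k) a"
  shows "G \<cong>\<^sub>g add_pendant (path_graph (length xs)) (Suc (length xs)) (Suc k)"
proof -
  obtain f where f: "inj_on f (set xs)" "f ` set xs = {1..length xs}"
    "map_prod f f ` path_edges xs = parcs (path_graph (length xs))"
    "\<And>i. i < length xs \<Longrightarrow> f (xs ! i) = Suc i"
    using path_iso[OF xs(1)] by metis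
  define g where "g = f(a := Suc (length xs))"
  have g: "g x = f x" if "x \<in> set xs" for x using that xs(2) by (auto simp: g_def)
  have ga: "g a = Suc (length xs)" by (simp add: g_def)
  have im: "g ` set xs = {1..length xs}" using f(2) g by simp
  have "inj_on g (set xs)" using f(1) g by (simp cong: inj_on_cong)
  then have inj: "inj_on g (insert a (set xs))" using im ga xs(2) by simp
  have "map_prod g g ` path_edges xs = map_prod f f ` path_edges xs"
    using path_edges_sub[of xs] g by (intro image_cong refl) auto
  moreover have "map_prod g g ` bridge (xs ! k) a = bridge (Suc k) (Suc (length xs))"
    using g[of "xs ! k"] f(4)[OF xs(3)] xs(3) ga by (simp add: bridge_def)
  ultimately have "map_prod g g ` parcs G = parcs (add_pendant (path_graph (length xs)) (Suc (length xs)) (Suc k))"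
    unfolding G(2) image_Un pendant_parcs f(3) by simp
  moreover have "parcs G \<subseteq> pverts G \<times> pverts G"
    using path_edges_sub[of xs] xs(3) unfolding G by (auto simp: bridge_def)
  ultimately show ?thesis
    using inj im ga G(1) by (intro graph_isoI[where f = g]) (auto simp: pendant_verts)
qed

lemma unbranched_iso:
  assumes T: "is_tree (pverts G) (parcs G)" and low: "\<And>v. card (parcs G `` {v}) \<le> 2"
  shows "G \<cong>\<^sub>g path_graph (card (pverts G))"
proof -
  obtain xs where xs: "distinct xs" "set xs = pverts G" "parcs G = path_edges xs"
    by (rule tree_path[OF T low])
  then show ?thesis using path_graph_iso[of xs G] distinct_card[OF xs(1)] by simp
qed

lemma A_like_iso:
  assumes T: "is_tree (pverts G) (parcs G)" and A: "A_like (parcs G)"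
  shows "G \<cong>\<^sub>g A_graph (card (pverts G))"
proof -
  obtain a b u ys where *: "distinct (b # u # ys)" "a \<notin> set (b # u # ys)"
    "pverts G = insert a (set (b # u # ys))" "parcs G = path_edges (b # u # ys) \<union> bridge u a"
    by (rule A_like_path[OF T A])
  have "card (pverts G) = Suc (length (b # u # ys))"
    using distinct_card[OF *(1)] *(2) unfolding *(3) by simp
  then show ?thesis
    using pendant_iso[OF *(1,2), of 1 G] *(3,4) unfolding A_graph_def by (simp add: numeral_2_eq_2)
qed

lemma B_like_iso:
  assumes T: "is_tree (pverts G) (parcs G)" and B: "B_like (parcs G)"
  shows "G \<cong>\<^sub>g B_graph (card (pverts G))"
proof -
  obtain a z y u ys where *: "distinct (z # y # u # ys)" "a \<notin> set (z # y # u # ys)"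
    "pverts G = insert a (set (z # y # u # ys))" "parcs G = path_edges (z # y # u # ys) \<union> bridge u a"
    by (rule B_like_path[OF T B])
  have "card (pverts G) = Suc (length (z # y # u # ys))"
    using distinct_card[OF *(1)] *(2) unfolding *(3) by simp
  then show ?thesis
    using pendant_iso[OF *(1,2), of 2 G] *(3,4) unfolding B_graph_def by (simp add: numeral_2_eq_2 numeral_3_eq_3)
qed

section \<open>The three largest radii among trees\<close>

text \<open>
  \<open>V\<close> carries finitely many trees, so one with property \<open>Q\<close> has the largest radius. It cannot be
  improved within \<open>Q\<close>, hence has property \<open>R\<close> and radius \<open>r\<close>.
\<close>

lemma maximal_tree:
  assumes improve: "\<And>F. is_tree V F \<Longrightarrow> Q F \<Longrightarrow> \<not> R F
      \<Longrightarrow> \<exists>F'. is_tree V F' \<and> Q F' \<and> radius V F < radius V F'"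
    and extremal: "\<And>F. is_tree V F \<Longrightarrow> R F \<Longrightarrow> radius V F = r"
    and T: "is_tree V E" and Q: "Q E"
  shows "radius V E \<le> r" and "\<not> R E \<Longrightarrow> radius V E < r"
proof -
  define S where "S = {F. is_tree V F \<and> Q F}"
  have "S \<subseteq> Pow (V \<times> V)" using is_tree_sub by (auto simp: S_def)
  then have fin: "finite S" using is_tree_finite[OF T] by (meson finite_Pow_iff finite_SigmaI finite_subset)
  have le: "radius V E \<le> r" if E: "E \<in> S" for E
  proof -
    obtain F where F: "F \<in> S" and max: "\<And>F'. F' \<in> S \<Longrightarrow> radius V F' \<le> radius V F"
    proof -
      have "Max (radius V ` S) \<in> radius V ` S" using fin E by (intro Max_in) auto
      then obtain F where "F \<in> S" "radius V F = Max (radius V ` S)" by force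
      then show ?thesis using that[of F] fin by simp
    qed
    have "R F" using improve[of F] F max unfolding S_def by (metis mem_Collect_eq not_le)
    then show ?thesis using extremal[of F] F max[OF E] by (simp add: S_def)
  qed
  show "radius V E \<le> r" using le T Q by (simp add: S_def)
  show "radius V E < r" if "\<not> R E"
    using improve[OF T Q that] le unfolding S_def by (metis less_le_trans mem_Collect_eq)
qed

abbreviation branched :: "'a rel \<Rightarrow> bool" where
  "branched E \<equiv> \<exists>v. 3 \<le> card (E `` {v})"

lemma unbranched: "\<not> branched E \<Longrightarrow> card (E `` {v}) \<le> 2"
  by (metis not_less_eq_eq numeral_2_eq_2 numeral_3_eq_3)

lemma radius_iso:
  assumes T: "is_tree V F" and iso: "\<lparr>pverts = V, parcs = F\<rparr> \<cong>\<^sub>g H"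
  shows "radius V F = \<rho> H"
  using rho_iso[of "\<lparr>pverts = V, parcs = F\<rparr>" H] rho_tree[of "\<lparr>pverts = V, parcs = F\<rparr>"]
    is_tree_sym_connected[OF T] is_tree_finite[OF T] assms by simp

lemma path_maximal:
  assumes T: "is_tree V E"
  shows "radius V E \<le> \<rho> (path_graph (card V))"
    and "branched E \<Longrightarrow> radius V E < \<rho> (path_graph (card V))"
proof -
  have improve: "\<exists>F'. is_tree V F' \<and> True \<and> radius V F < radius V F'"
    if "is_tree V F" "True" "\<not> \<not> branched F" for F
    using that better_tree by auto
  have extremal: "radius V F = \<rho> (path_graph (card V))" if "is_tree V F" "\<not> branched F" for F
    using unbranched_iso[of "\<lparr>pverts = V, parcs = F\<rparr>"] unbranched[OF that(2)] radius_iso[OF that(1)] that(1)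
    by simp
  note M = maximal_tree[where V = V and Q = "\<lambda>_. True" and R = "\<lambda>F. \<not> branched F", OF improve extremal T TrueI]
  show "radius V E \<le> \<rho> (path_graph (card V))" using M(1) by blast
  show "branched E \<Longrightarrow> radius V E < \<rho> (path_graph (card V))" using M(2) by blast
qed

lemma A_maximal:
  assumes T: "is_tree V E" and Q: "branched E"
  shows "radius V E \<le> \<rho> (A_graph (card V))"
    and "\<not> A_like E \<Longrightarrow> radius V E < \<rho> (A_graph (card V))"
proof -
  have improve: "\<exists>F'. is_tree V F' \<and> branched F' \<and> radius V F < radius V F'"
    if F: "is_tree V F" "branched F" "\<not> A_like F" for F
  proof -
    obtain u where "3 \<le> card (F `` {u})" using F(2) by blast
    from better_branching_tree[OF F(1) this F(3)] show ?thesis by blast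
  qed
  have extremal: "radius V F = \<rho> (A_graph (card V))" if "is_tree V F" "A_like F" for F
    using A_like_iso[of "\<lparr>pverts = V, parcs = F\<rparr>"] radius_iso[OF that(1)] that by simp
  note M = maximal_tree[where V = V and Q = branched and R = A_like, OF improve extremal T Q]
  show "radius V E \<le> \<rho> (A_graph (card V))" using M(1) by blast
  show "\<not> A_like E \<Longrightarrow> radius V E < \<rho> (A_graph (card V))" using M(2) by blast
qed

lemma B_maximal:
  assumes T: "is_tree V E" and six: "6 \<le> card V" and Q: "branched E" "\<not> A_like E"
  shows "radius V E \<le> \<rho> (B_graph (card V))"
    and "\<not> B_like E \<Longrightarrow> radius V E < \<rho> (B_graph (card V))"
proof -
  have improve: "\<exists>F'. is_tree V F' \<and> (branched F' \<and> \<not> A_like F') \<and> radius V F < radius V F'"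
    if F: "is_tree V F" "branched F \<and> \<not> A_like F" "\<not> B_like F" for F
  proof -
    obtain u where "3 \<le> card (F `` {u})" using F(2) by blast
    from better_than_B_like[OF F(1) six this] F show ?thesis unfolding improves_off_A_def by blast
  qed
  have extremal: "radius V F = \<rho> (B_graph (card V))" if "is_tree V F" "B_like F" for F
    using B_like_iso[of "\<lparr>pverts = V, parcs = F\<rparr>"] radius_iso[OF that(1)] that by simp
  note M = maximal_tree[where V = V and Q = "\<lambda>F. branched F \<and> \<not> A_like F" and R = B_like,
      OF improve extremal T conjI[OF Q]]
  show "radius V E \<le> \<rho> (B_graph (card V))" using M(1) by blast
  show "\<not> B_like E \<Longrightarrow> radius V E < \<rho> (B_graph (card V))" using M(2) by blast
qed

lemma A_graph_facts:
  assumes "4 \<le> n"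
  shows "is_tree (pverts (A_graph n)) (parcs (A_graph n))" and "card (pverts (A_graph n)) = n"
    and "branched (parcs (A_graph n))"
proof -
  obtain k where n: "n = Suc k" "3 \<le> k" using assms by (cases n) auto
  have A: "A_graph n = add_pendant (path_graph k) (Suc k) 2" by (simp add: A_graph_def n)
  have V: "pverts (A_graph n) = {1..k} \<union> {Suc k}" by (simp add: A pendant_verts)
  show T: "is_tree (pverts (A_graph n)) (parcs (A_graph n))"
    unfolding V unfolding A using n by (intro pendant_tree) auto
  show "card (pverts (A_graph n)) = n" unfolding V using n by simp
  have "{1, 3, Suc k} \<subseteq> parcs (A_graph n) `` {2}"
    using n(2) by (auto simp: A add_pendant_def path_graph_def)
  then have "card {1, 3, Suc k} \<le> card (parcs (A_graph n) `` {2})"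
    by (rule card_mono[OF tree_finite_nbrs[OF T]])
  then show "branched (parcs (A_graph n))" using n by (intro exI[of _ 2]) auto
qed

lemma B_graph_facts:
  assumes "6 \<le> n"
  shows "is_tree (pverts (B_graph n)) (parcs (B_graph n))" and "card (pverts (B_graph n)) = n"
    and "branched (parcs (B_graph n))" and "\<not> A_like (parcs (B_graph n))"
    and "\<rho> (path_graph (n - 1)) < \<rho> (B_graph n)"
proof -
  obtain k where n: "n = Suc k" "5 \<le> k" using assms by (cases n) auto
  let ?E = "parcs (B_graph n)"
  have B: "B_graph n = add_pendant (path_graph k) (Suc k) 3" by (simp add: B_graph_def n)
  have V: "pverts (B_graph n) = {1..k} \<union> {Suc k}" by (simp add: B pendant_verts)
  show T: "is_tree (pverts (B_graph n)) ?E"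
    unfolding V unfolding B using n by (intro pendant_tree) auto
  show "card (pverts (B_graph n)) = n" unfolding V using n by simp
  have E: "(i, j) \<in> ?E \<longleftrightarrow> (i \<in> {1..k} \<and> j \<in> {1..k} \<and> (j = Suc i \<or> i = Suc j))
      \<or> (i = Suc k \<and> j = 3) \<or> (i = 3 \<and> j = Suc k)" for i j
    by (auto simp: B add_pendant_def path_graph_def)
  have "{2, 4, Suc k} \<subseteq> ?E `` {3}" using n(2) by (auto simp: E)
  then have "card {2, 4, Suc k} \<le> card (?E `` {3})"
    by (rule card_mono[OF tree_finite_nbrs[OF T]])
  then have three: "3 \<le> card (?E `` {3})" using n by simp
  then show "branched ?E" by blast
  have ne: "S \<noteq> {y}" if "x \<in> S" "x \<noteq> y" for x y :: nat and S using that by blast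
  have "1 \<in> ?E `` {2}" "5 \<in> ?E `` {4}" using n(2) by (simp_all add: E)
  then have "?E `` {2} \<noteq> {3}" "?E `` {4} \<noteq> {3}"
    using ne[of 1 "?E `` {2}" 3] ne[of 5 "?E `` {4}" 3] by simp_all
  moreover have "2 \<in> ?E `` {3}" "4 \<in> ?E `` {3}" using n(2) by (simp_all add: E)
  ultimately show "\<not> A_like ?E" using not_A_like_nonleaves[OF T three, of 2 4] by simp
  have "radius {1..k} (parcs (path_graph k))
      < radius ({1..k} \<union> {Suc k}) (parcs (path_graph k) \<union> {} \<union> bridge 3 (Suc k))"
    using n by (intro radius_less_join path_graph_tree is_tree.single) auto
  also have "\<dots> = \<rho> (B_graph n)" using rho_tree[OF T] unfolding V by (simp add: B pendant_parcs)
  finally show "\<rho> (path_graph (n - 1)) < \<rho> (B_graph n)"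
    using rho_tree[of "path_graph k"] path_graph_tree[of k] n by simp
qed

lemma rho_path_mono:
  assumes "1 \<le> k" "k \<le> n"
  shows "\<rho> (path_graph k) \<le> \<rho> (path_graph n)"
  using assms(2)
proof (induction n rule: dec_induct)
  case (step n)
  have n: "1 \<le> n" using step.hyps assms(1) by simp
  have "radius {1..n} (parcs (path_graph n)) < radius ({1..n} \<union> {Suc n}) (parcs (path_graph n) \<union> {} \<union> bridge n (Suc n))"
    using n by (intro radius_less_join path_graph_tree is_tree.single) auto
  moreover have "{1..n} \<union> {Suc n} = {1..Suc n}" by auto
  ultimately have "\<rho> (path_graph n) < \<rho> (path_graph (Suc n))"
    using rho_tree[of "path_graph n"] rho_tree[of "path_graph (Suc n)"]
      path_graph_tree[OF n] path_graph_tree[of "Suc n"] path_graph_Suc[OF n] by simp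
  then show ?case using step.IH by simp
qed simp

theorem theorem1p1:
  fixes G :: "'a pair_pre_digraph" and m :: nat
  assumes "m \<ge> 5"
    and "pair_graph G"
    and "Digraph_Component.connected (with_proj G)"
    and "card (edges G) = m"
    and "\<not> G \<cong>\<^sub>g path_graph (m + 1)"
    and "\<not> G \<cong>\<^sub>g A_graph (m + 1)"
  shows "\<rho> G \<le> \<rho> (B_graph (m + 1))
    \<and> \<rho> (B_graph (m + 1)) < \<rho> (A_graph (m + 1))
    \<and> \<rho> (A_graph (m + 1)) < \<rho> (path_graph (m + 1))
    \<and> (\<rho> G = \<rho> (B_graph (m + 1)) \<longleftrightarrow> G \<cong>\<^sub>g B_graph (m + 1))"
proof -
  have m: "4 \<le> m + 1" "6 \<le> m + 1" using assms(1) by simp_all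
  note A = A_graph_facts[OF m(1)] and B = B_graph_facts[OF m(2)]
  have BA: "\<rho> (B_graph (m + 1)) < \<rho> (A_graph (m + 1))"
    using A_maximal(2)[OF B(1,3,4)] rho_tree[OF B(1)] B(2) by simp
  have AP: "\<rho> (A_graph (m + 1)) < \<rho> (path_graph (m + 1))"
    using path_maximal(2)[OF A(1,3)] rho_tree[OF A(1)] A(2) by simp
  let ?V = "pverts G" and ?E = "parcs G"
  note J = pair_graph_sym_connected[OF assms(2,3)]
  obtain F where F: "F \<subseteq> ?E" "is_tree ?V F" using spanning_tree[OF J] by blast
  have edges: "undirected ?E = edges G" by (simp add: undirected_def edges_def)
  have "?E \<subseteq> ?V \<times> ?V" using J(1) by (simp add: sym_connected_def)
  then have "finite ?E" using J(2) by (meson finite_SigmaI finite_subset)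
  then have fin: "finite (undirected ?E)" by (simp add: undirected_def)
  have sub: "undirected F \<subseteq> undirected ?E" using F(1) by (auto simp: undirected_def)
  have le: "card ?V \<le> m + 1"
    using card_mono[OF fin sub] is_tree_card_edges[OF F(2)] assms(4) edges by simp
  have iso_eq: "\<rho> G = \<rho> (B_graph (m + 1))" if "G \<cong>\<^sub>g B_graph (m + 1)"
    using rho_iso[OF J that] by simp
  have "\<rho> G \<le> \<rho> (B_graph (m + 1)) \<and> (\<rho> G = \<rho> (B_graph (m + 1)) \<longrightarrow> G \<cong>\<^sub>g B_graph (m + 1))"
  proof (cases "card ?V = m + 1")
    case True
    then have "card (undirected F) = card (undirected ?E)"
      using is_tree_card_edges[OF F(2)] assms(4) edges by simp
    then have "undirected ?E = undirected F" using card_subset_eq[OF fin sub] by simp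
    then have EF: "?E = F" using undirected_inject[of ?E F] is_tree_sym[OF F(2)] J(1) by (simp add: sym_connected_def)
    then have T: "is_tree ?V ?E" using F(2) by simp
    have "branched ?E" using unbranched_iso[OF T] unbranched assms(5) True by metis
    moreover have "\<not> A_like ?E" using A_like_iso[OF T] assms(6) True by metis
    ultimately have le: "radius ?V ?E \<le> \<rho> (B_graph (m + 1))"
      and less: "\<not> B_like ?E \<Longrightarrow> radius ?V ?E < \<rho> (B_graph (m + 1))"
      using B_maximal[OF T] m(2) True by simp_all
    have "G \<cong>\<^sub>g B_graph (m + 1)" if "B_like ?E" using B_like_iso[OF T that] True by simp
    then show ?thesis using le less rho_tree[OF T] by fastforce
  next
    case False
    have "1 \<le> card ?V" using J(2,3) by (simp add: Suc_le_eq card_gt_0_iff)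
    have "\<rho> G = radius ?V ?E" by (rule rho_radius[OF J])
    also have "\<dots> \<le> radius ?V F"
      using J F is_tree_sym_connected[OF F(2)] is_tree_sym[OF F(2)]
      by (intro radius_mono gdist_mono) (auto simp: sym_connected_def)
    also have "\<dots> \<le> \<rho> (path_graph (card ?V))" by (rule path_maximal(1)[OF F(2)])
    also have "\<dots> \<le> \<rho> (path_graph m)"
      using rho_path_mono[OF \<open>1 \<le> card ?V\<close>, of m] False le by simp
    also have "\<dots> < \<rho> (B_graph (m + 1))" using B(5) by simp
    finally show ?thesis by simp
  qed
  then show ?thesis using BA AP iso_eq by blast
qed

end
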